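(* Let $(X,\omega)$ be a compact connected Kähler manifold. For each $p\ge1$ let $L_p$ be a pseudo-effective holomorphic line bundle on $X$ equipped with a continuous Hermitian metric $h_p$. Let $\{V_\alpha\}$ be an open cover of $X$ by coordinate polydiscs, $e_p^\alpha$ holomorphic frames of $L_p$ on $V_\alpha$, $\phi^\alpha\in C(V_\alpha)$ continuous real functions, and $A_p>0$ constants with $A_p\to\infty$, such that for every $\alpha$, $\phi_p^\alpha/A_p\to\phi^\alpha$ locally uniformly on $V_\alpha$ as $p\to\infty$, where $\phi_p^\alpha$ is the local weight of $h_p$ given by $h_p(e_p^\alpha,e_p^\alpha)=e^{-2\phi_p^\alpha}$. Then for all $\alpha,\beta$ there exists a pluriharmonic function $\psi^{\alpha\beta}$ on $V_\alpha\cap V_\beta$ such that $$\phi^\alpha=\phi^\beta+\psi^{\alpha\beta}\quad\text{on }V_\alpha\cap V_\beta.$$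
   Context: A continuous Hermitian metric on a holomorphic line bundle is one whose local weights with respect to holomorphic frames are continuous real-valued functions. A holomorphic line bundle is pseudo-effective if it admits a singular Hermitian metric with positive (semi-positive) curvature current. *)

theory Defs
  imports "HOL-Analysis.Analysis"
begin

section \<open>Calculus on open subsets of complex n-space\<close>

text \<open>
  The model space is \<open>complex^'n\<close>.  All sets \<open>S\<close> below are meant to be open.
\<close>

primrec Ck_on ::
  "nat \<Rightarrow> 'e::real_normed_vector set \<Rightarrow> ('e \<Rightarrow> 'f::real_normed_vector) \<Rightarrow> bool" where
  "Ck_on 0 S f \<longleftrightarrow> continuous_on S f"
| "Ck_on (Suc k) S f \<longleftrightarrow>
     (\<forall>z\<in>S. f differentiable (at z)) \<and> (\<forall>v. Ck_on k S (\<lambda>z. frechet_derivative f (at z) v))"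

definition smooth_on ::
  "'e::real_normed_vector set \<Rightarrow> ('e \<Rightarrow> 'f::real_normed_vector) \<Rightarrow> bool" where
  "smooth_on S f \<longleftrightarrow> (\<forall>k. Ck_on k S f)"

definition holo_on :: "(complex^'n) set \<Rightarrow> (complex^'n \<Rightarrow> complex) \<Rightarrow> bool" where
  "holo_on S f \<longleftrightarrow>
     (\<forall>z\<in>S. \<exists>D. (f has_derivative D) (at z) \<and> (\<forall>c v. D (c *s v) = c * D v))"

definition holo_map_on :: "(complex^'n) set \<Rightarrow> (complex^'n \<Rightarrow> complex^'m) \<Rightarrow> bool" where
  "holo_map_on S f \<longleftrightarrow> (\<forall>j. holo_on S (\<lambda>z. f z $ j))"

text \<open>The Wirtinger derivatives \<open>\<partial>/\<partial>z\<^sub>j\<close> and \<open>\<partial>/\<partial>zbar\<^sub>j\<close>, where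
  \<open>\<partial>/\<partial>x\<^sub>j\<close> and \<open>\<partial>/\<partial>y\<^sub>j\<close> are the derivatives in the directions \<open>axis j 1\<close> and \<open>axis j \<i>\<close>.\<close>

definition d_z :: "'n::finite \<Rightarrow> (complex^'n \<Rightarrow> complex) \<Rightarrow> complex^'n \<Rightarrow> complex" where
  "d_z j f z =
     (frechet_derivative f (at z) (axis j 1) - \<i> * frechet_derivative f (at z) (axis j \<i>)) / 2"

definition d_zbar :: "'n::finite \<Rightarrow> (complex^'n \<Rightarrow> complex) \<Rightarrow> complex^'n \<Rightarrow> complex" where
  "d_zbar j f z =
     (frechet_derivative f (at z) (axis j 1) + \<i> * frechet_derivative f (at z) (axis j \<i>)) / 2"

definition polydisc :: "complex^'n \<Rightarrow> ('n \<Rightarrow> real) \<Rightarrow> (complex^'n) set" where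
  "polydisc a r = {z. \<forall>j. norm (z $ j - a $ j) < r j}"


section \<open>Complex manifolds\<close>

text \<open>A chart \<open>(U, \<kappa>)\<close> consists of its domain and the coordinate map;
  the inverse coordinate map is \<open>inv_into U \<kappa>\<close>.\<close>

type_synonym ('a, 'n) chart = "'a set \<times> ('a \<Rightarrow> complex^'n)"

definition is_chart :: "'a topology \<Rightarrow> ('a, 'n::finite) chart \<Rightarrow> bool" where
  "is_chart X = (\<lambda>(U, \<kappa>). openin X U \<and> open (\<kappa> ` U) \<and>
     homeomorphic_map (subtopology X U) (top_of_set (\<kappa> ` U)) \<kappa>)"

definition transition :: "('a, 'n::finite) chart \<Rightarrow> ('a, 'n) chart \<Rightarrow> complex^'n \<Rightarrow> complex^'n" where
  "transition c d = snd d \<circ> inv_into (fst c) (snd c)"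

definition compatible :: "('a, 'n::finite) chart \<Rightarrow> ('a, 'n) chart \<Rightarrow> bool" where
  "compatible c d \<longleftrightarrow>
     holo_map_on (snd c ` (fst c \<inter> fst d)) (transition c d) \<and>
     holo_map_on (snd d ` (fst c \<inter> fst d)) (transition d c)"

definition complex_manifold :: "'a topology \<Rightarrow> ('a, 'n::finite) chart set \<Rightarrow> bool" where
  "complex_manifold X A \<longleftrightarrow>
     Hausdorff_space X \<and> second_countable X \<and>
     (\<forall>c\<in>A. is_chart X c) \<and> (\<Union>c\<in>A. fst c) = topspace X \<and>
     (\<forall>c\<in>A. \<forall>d\<in>A. compatible c d)"

text \<open>The atlas \<open>A\<close> need not be maximal, so the chart of a coordinate polydisc is only
  required to be compatible with \<open>A\<close>.\<close>

definition coordinate_polydisc :: "'a topology \<Rightarrow> ('a, 'n::finite) chart set \<Rightarrow> 'a set \<Rightarrow> bool" where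
  "coordinate_polydisc X A V \<longleftrightarrow>
     (\<exists>\<kappa> a r. is_chart X (V, \<kappa>) \<and> (\<forall>c\<in>A. compatible (V, \<kappa>) c) \<and>
        (\<forall>j. 0 < r j) \<and> \<kappa> ` V = polydisc a r)"

definition holomorphic_fun :: "('a, 'n::finite) chart set \<Rightarrow> 'a set \<Rightarrow> ('a \<Rightarrow> complex) \<Rightarrow> bool" where
  "holomorphic_fun A W f \<longleftrightarrow>
     (\<forall>(U, \<kappa>)\<in>A. holo_on (\<kappa> ` (U \<inter> W)) (f \<circ> inv_into U \<kappa>))"

text \<open>A real function \<open>u\<close> of class \<open>C\<^sup>2\<close> with \<open>\<partial>\<^sup>2u/\<partial>z\<^sub>j\<partial>zbar\<^sub>k = 0\<close> for all \<open>j\<close>, \<open>k\<close>.\<close>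

definition pluriharmonic :: "('a, 'n::finite) chart set \<Rightarrow> 'a set \<Rightarrow> ('a \<Rightarrow> real) \<Rightarrow> bool" where
  "pluriharmonic A W u \<longleftrightarrow>
     (\<forall>(U, \<kappa>)\<in>A.
        Ck_on 2 (\<kappa> ` (U \<inter> W)) (u \<circ> inv_into U \<kappa>) \<and>
        (\<forall>z\<in>\<kappa> ` (U \<inter> W). \<forall>j k.
           d_z j (d_zbar k (\<lambda>w. of_real (u (inv_into U \<kappa> w)))) z = 0))"


section \<open>Kaehler manifolds\<close>

text \<open>
  A real 2-form is given by its local expressions: \<open>\<omega> c z u v\<close> is its value at the point with
  coordinate \<open>z\<close> in the chart \<open>c\<close> on the tangent vectors with coordinates \<open>u\<close> and \<open>v\<close>.
  The local expressions are related by pull-back along the transition maps.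
\<close>

type_synonym ('a, 'n) form2 =
  "('a, 'n) chart \<Rightarrow> complex^'n \<Rightarrow> complex^'n \<Rightarrow> complex^'n \<Rightarrow> real"

definition smooth_2form :: "('a, 'n::finite) chart set \<Rightarrow> ('a, 'n) form2 \<Rightarrow> bool" where
  "smooth_2form A \<omega> \<longleftrightarrow>
     (\<forall>c\<in>A. \<forall>z\<in>snd c ` fst c. bilinear (\<omega> c z) \<and> (\<forall>u. \<omega> c z u u = 0)) \<and>
     (\<forall>c\<in>A. \<forall>u v. smooth_on (snd c ` fst c) (\<lambda>z. \<omega> c z u v)) \<and>
     (\<forall>c\<in>A. \<forall>d\<in>A. \<forall>z\<in>snd c ` (fst c \<inter> fst d). \<forall>u v.
        \<omega> c z u v =
        \<omega> d (transition c d z)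
          (frechet_derivative (transition c d) (at z) u)
          (frechet_derivative (transition c d) (at z) v))"

text \<open>For constant vector fields \<open>u\<close>, \<open>v\<close>, \<open>w\<close> all Lie brackets vanish, so
  \<open>d\<omega>(u,v,w)\<close> is the cyclic sum of the derivatives of the coefficients.\<close>

definition closed_2form :: "('a, 'n::finite) chart set \<Rightarrow> ('a, 'n) form2 \<Rightarrow> bool" where
  "closed_2form A \<omega> \<longleftrightarrow>
     (\<forall>c\<in>A. \<forall>z\<in>snd c ` fst c. \<forall>u v w.
        frechet_derivative (\<lambda>y. \<omega> c y v w) (at z) u +
        frechet_derivative (\<lambda>y. \<omega> c y w u) (at z) v +
        frechet_derivative (\<lambda>y. \<omega> c y u v) (at z) w = 0)"

text \<open>A form is of type (1,1) iff it is invariant under the complex structure \<open>v \<mapsto> \<i> v\<close>, and a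
  (1,1)-form is positive definite iff \<open>\<omega>(u, \<i> u) > 0\<close> for all tangent vectors \<open>u \<noteq> 0\<close>.\<close>

definition kaehler_form :: "('a, 'n::finite) chart set \<Rightarrow> ('a, 'n) form2 \<Rightarrow> bool" where
  "kaehler_form A \<omega> \<longleftrightarrow>
     smooth_2form A \<omega> \<and> closed_2form A \<omega> \<and>
     (\<forall>c\<in>A. \<forall>z\<in>snd c ` fst c.
        (\<forall>u v. \<omega> c z (\<i> *s u) (\<i> *s v) = \<omega> c z u v) \<and>
        (\<forall>u. u \<noteq> 0 \<longrightarrow> 0 < \<omega> c z u (\<i> *s u)))"

definition kaehler_manifold ::
  "'a topology \<Rightarrow> ('a, 'n::finite) chart set \<Rightarrow> ('a, 'n) form2 \<Rightarrow> bool" where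
  "kaehler_manifold X A \<omega> \<longleftrightarrow> complex_manifold X A \<and> kaehler_form A \<omega>"


section \<open>Holomorphic line bundles\<close>

text \<open>
  The record bundles the total space, the projection, the fibrewise vector space operations, and
  an atlas of local trivialisations.  A trivialisation \<open>(U, \<tau>)\<close> stands for the map
  \<open>v \<mapsto> (\<pi> v, \<tau> v)\<close> from the part of the total space over \<open>U\<close> to \<open>U \<times> \<complex>\<close>; the requirement
  that this is bijective and fibrewise linear makes every fibre a one-dimensional complex vector
  space.  The complex structure of the total space is the one determined by the trivialisations.
\<close>

record ('a, 'b) line_bundle =
  lb_top :: "'b topology"
  lb_proj :: "'b \<Rightarrow> 'a"
  lb_zero :: "'a \<Rightarrow> 'b"
  lb_add :: "'b \<Rightarrow> 'b \<Rightarrow> 'b"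
  lb_smul :: "complex \<Rightarrow> 'b \<Rightarrow> 'b"
  lb_trivs :: "('a set \<times> ('b \<Rightarrow> complex)) set"

definition fibre :: "('a, 'b) line_bundle \<Rightarrow> 'a \<Rightarrow> 'b set" where
  "fibre L x = {v \<in> topspace (lb_top L). lb_proj L v = x}"

definition over :: "('a, 'b) line_bundle \<Rightarrow> 'a set \<Rightarrow> 'b set" where
  "over L U = {v \<in> topspace (lb_top L). lb_proj L v \<in> U}"

definition local_trivialisation ::
  "'a topology \<Rightarrow> ('a, 'b) line_bundle \<Rightarrow> 'a set \<times> ('b \<Rightarrow> complex) \<Rightarrow> bool" where
  "local_trivialisation X L = (\<lambda>(U, \<tau>).
     openin X U \<and>
     homeomorphic_map (subtopology (lb_top L) (over L U))
       (prod_topology (subtopology X U) euclidean) (\<lambda>v. (lb_proj L v, \<tau> v)) \<and>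
     (\<forall>x\<in>U. \<tau> (lb_zero L x) = 0 \<and>
        (\<forall>v\<in>fibre L x. \<forall>w\<in>fibre L x. \<tau> (lb_add L v w) = \<tau> v + \<tau> w) \<and>
        (\<forall>v\<in>fibre L x. \<forall>c. \<tau> (lb_smul L c v) = c * \<tau> v)))"

definition holomorphic_line_bundle ::
  "'a topology \<Rightarrow> ('a, 'n::finite) chart set \<Rightarrow> ('a, 'b) line_bundle \<Rightarrow> bool" where
  "holomorphic_line_bundle X A L \<longleftrightarrow>
     continuous_map (lb_top L) X (lb_proj L) \<and>
     (\<forall>x\<in>topspace X. lb_zero L x \<in> fibre L x \<and>
        (\<forall>v\<in>fibre L x. \<forall>w\<in>fibre L x. lb_add L v w \<in> fibre L x) \<and>
        (\<forall>v\<in>fibre L x. \<forall>c. lb_smul L c v \<in> fibre L x)) \<and>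
     (\<forall>t\<in>lb_trivs L. local_trivialisation X L t) \<and>
     (\<Union>t\<in>lb_trivs L. fst t) = topspace X \<and>
     (\<forall>(U, \<tau>)\<in>lb_trivs L. \<forall>(V, \<sigma>)\<in>lb_trivs L.
        \<exists>g. holomorphic_fun A (U \<inter> V) g \<and>
            (\<forall>v\<in>over L (U \<inter> V). \<tau> v = g (lb_proj L v) * \<sigma> v))"

definition holomorphic_frame ::
  "('a, 'n::finite) chart set \<Rightarrow> ('a, 'b) line_bundle \<Rightarrow> 'a set \<Rightarrow> ('a \<Rightarrow> 'b) \<Rightarrow> bool" where
  "holomorphic_frame A L V e \<longleftrightarrow>
     (\<forall>x\<in>V. e x \<in> fibre L x \<and> e x \<noteq> lb_zero L x) \<and>
     (\<forall>(U, \<tau>)\<in>lb_trivs L. holomorphic_fun A (U \<inter> V) (\<tau> \<circ> e))"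


section \<open>Hermitian metrics\<close>

definition hermitian_metric ::
  "'a topology \<Rightarrow> ('a, 'b) line_bundle \<Rightarrow> ('b \<Rightarrow> 'b \<Rightarrow> complex) \<Rightarrow> bool" where
  "hermitian_metric X L h \<longleftrightarrow>
     (\<forall>x\<in>topspace X. \<forall>u\<in>fibre L x. \<forall>v\<in>fibre L x.
        (\<forall>w\<in>fibre L x. h (lb_add L u v) w = h u w + h v w) \<and>
        (\<forall>c. h (lb_smul L c u) v = c * h u v) \<and>
        h v u = cnj (h u v) \<and>
        (u \<noteq> lb_zero L x \<longrightarrow> 0 < Re (h u u)))"

definition local_weight ::
  "('b \<Rightarrow> 'b \<Rightarrow> complex) \<Rightarrow> 'a set \<Rightarrow> ('a \<Rightarrow> 'b) \<Rightarrow> ('a \<Rightarrow> real) \<Rightarrow> bool" where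
  "local_weight h V e \<phi> \<longleftrightarrow> (\<forall>x\<in>V. h (e x) (e x) = of_real (exp (- 2 * \<phi> x)))"

definition continuous_hermitian_metric ::
  "'a topology \<Rightarrow> ('a, 'n::finite) chart set \<Rightarrow> ('a, 'b) line_bundle
    \<Rightarrow> ('b \<Rightarrow> 'b \<Rightarrow> complex) \<Rightarrow> bool" where
  "continuous_hermitian_metric X A L h \<longleftrightarrow>
     hermitian_metric X L h \<and>
     (\<forall>V e \<phi>. openin X V \<and> holomorphic_frame A L V e \<and> local_weight h V e \<phi> \<longrightarrow>
        continuous_map (subtopology X V) euclideanreal \<phi>)"


section \<open>Singular Hermitian metrics and pseudo-effective line bundles\<close>

fun exp_ereal :: "ereal \<Rightarrow> ennreal" where
  "exp_ereal (ereal r) = ennreal (exp r)"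
| "exp_ereal PInfty = top"
| "exp_ereal MInfty = 0"

definition locally_integrable_on ::
  "(complex^'n) set \<Rightarrow> (complex^'n \<Rightarrow> ereal) \<Rightarrow> bool" where
  "locally_integrable_on S f \<longleftrightarrow>
     (\<forall>K. compact K \<and> K \<subseteq> S \<longrightarrow>
        (AE z in lebesgue. z \<in> K \<longrightarrow> \<bar>f z\<bar> \<noteq> \<infinity>) \<and>
        set_integrable lebesgue K (\<lambda>z. real_of_ereal (f z)))"

text \<open>Singular metrics are given by their squared norm \<open>N\<close>; the weight \<open>\<phi>\<close> with respect to a
  frame \<open>e\<close> satisfies \<open>N(c e) = |c|\<^sup>2 exp(-2\<phi>)\<close> with \<open>0 \<cdot> \<infinity> = 0\<close>, and may take the
  values \<open>\<plusminus>\<infinity>\<close>.\<close>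

definition singular_weight ::
  "('a, 'b) line_bundle \<Rightarrow> ('b \<Rightarrow> ennreal) \<Rightarrow> 'a set \<Rightarrow> ('a \<Rightarrow> 'b) \<Rightarrow> ('a \<Rightarrow> ereal) \<Rightarrow> bool" where
  "singular_weight L N V e \<phi> \<longleftrightarrow>
     (\<forall>x\<in>V. \<forall>c. N (lb_smul L c (e x)) = ennreal ((norm c)\<^sup>2) * exp_ereal (- (2 * \<phi> x)))"

definition singular_hermitian_metric ::
  "'a topology \<Rightarrow> ('a, 'n::finite) chart set \<Rightarrow> ('a, 'b) line_bundle \<Rightarrow> ('b \<Rightarrow> ennreal) \<Rightarrow> bool" where
  "singular_hermitian_metric X A L N \<longleftrightarrow>
     (\<forall>V e. openin X V \<and> holomorphic_frame A L V e \<longrightarrow>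
        (\<exists>\<phi>. singular_weight L N V e \<phi> \<and>
           (\<forall>(U, \<kappa>)\<in>A. locally_integrable_on (\<kappa> ` (U \<inter> V)) (\<phi> \<circ> inv_into U \<kappa>))))"

definition test_function :: "(complex^'n) set \<Rightarrow> (complex^'n \<Rightarrow> real) \<Rightarrow> bool" where
  "test_function S \<theta> \<longleftrightarrow>
     smooth_on UNIV \<theta> \<and> compact (closure {z. \<theta> z \<noteq> 0}) \<and> closure {z. \<theta> z \<noteq> 0} \<subseteq> S"

text \<open>The distribution \<open>\<partial>\<^sup>2\<phi>/\<partial>z\<^sub>j\<partial>zbar\<^sub>k\<close> on \<open>S\<close>, evaluated at the test function \<open>\<theta>\<close>.\<close>

definition ddbar_distribution ::
  "(complex^'n::finite) set \<Rightarrow> (complex^'n \<Rightarrow> ereal) \<Rightarrow> 'n \<Rightarrow> 'n \<Rightarrow> (complex^'n \<Rightarrow> real) \<Rightarrow> complex" where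
  "ddbar_distribution S \<phi> j k \<theta> =
     set_lebesgue_integral lebesgue S
       (\<lambda>z. of_real (real_of_ereal (\<phi> z)) * d_z j (d_zbar k (\<lambda>w. of_real (\<theta> w))) z)"

text \<open>The (1,1)-current \<open>T = \<i> \<Sum> T\<^sub>j\<^sub>k dz\<^sub>j \<and> dzbar\<^sub>k\<close>, where
  \<open>T\<^sub>j\<^sub>k = \<partial>\<^sup>2\<phi>/\<partial>z\<^sub>j\<partial>zbar\<^sub>k\<close>, is positive iff for every vector \<open>\<xi>\<close> the distribution
  \<open>\<Sum> T\<^sub>j\<^sub>k \<xi>\<^sub>j cnj \<xi>\<^sub>k\<close> is nonnegative on nonnegative test functions.\<close>

definition ddbar_current_positive ::
  "(complex^'n::finite) set \<Rightarrow> (complex^'n \<Rightarrow> ereal) \<Rightarrow> bool" where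
  "ddbar_current_positive S \<phi> \<longleftrightarrow>
     (\<forall>\<xi> \<theta>. test_function S \<theta> \<and> (\<forall>z. 0 \<le> \<theta> z) \<longrightarrow>
        (\<Sum>j\<in>UNIV. \<Sum>k\<in>UNIV. ddbar_distribution S \<phi> j k \<theta> * \<xi> $ j * cnj (\<xi> $ k)) \<in> \<real>\<^sub>\<ge>\<^sub>0)"

text \<open>The curvature current of a singular metric is, up to a positive constant factor depending on
  conventions, \<open>\<i> \<Sum> (\<partial>\<^sup>2\<phi>/\<partial>z\<^sub>j\<partial>zbar\<^sub>k) dz\<^sub>j \<and> dzbar\<^sub>k\<close> for any local weight \<open>\<phi>\<close>.\<close>

definition positive_curvature_current ::
  "'a topology \<Rightarrow> ('a, 'n::finite) chart set \<Rightarrow> ('a, 'b) line_bundle \<Rightarrow> ('b \<Rightarrow> ennreal) \<Rightarrow> bool" where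
  "positive_curvature_current X A L N \<longleftrightarrow>
     (\<forall>V e \<phi>. openin X V \<and> holomorphic_frame A L V e \<and> singular_weight L N V e \<phi> \<longrightarrow>
        (\<forall>(U, \<kappa>)\<in>A. ddbar_current_positive (\<kappa> ` (U \<inter> V)) (\<phi> \<circ> inv_into U \<kappa>)))"

definition pseudo_effective ::
  "'a topology \<Rightarrow> ('a, 'n::finite) chart set \<Rightarrow> ('a, 'b) line_bundle \<Rightarrow> bool" where
  "pseudo_effective X A L \<longleftrightarrow>
     (\<exists>N. singular_hermitian_metric X A L N \<and> positive_curvature_current X A L N)"


section \<open>Locally uniform convergence\<close>

definition locally_uniform_limit ::
  "'a topology \<Rightarrow> 'a set \<Rightarrow> (nat \<Rightarrow> 'a \<Rightarrow> real) \<Rightarrow> ('a \<Rightarrow> real) \<Rightarrow> bool" where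
  "locally_uniform_limit X V f g \<longleftrightarrow>
     (\<forall>x\<in>V. \<exists>W. openin X W \<and> x \<in> W \<and> W \<subseteq> V \<and> uniform_limit W f g sequentially)"

end

theory Submission
  imports Defs "HOL-Complex_Analysis.Cauchy_Integral_Formula"
begin

text \<open>
  Let \<open>g\<^sub>p\<close> be the nowhere vanishing holomorphic function with
  \<open>e\<^sub>p\<^sup>\<beta> = g\<^sub>p e\<^sub>p\<^sup>\<alpha>\<close> on \<open>V\<^sub>\<alpha> \<inter> V\<^sub>\<beta>\<close>.  Comparing \<open>h\<^sub>p\<close> on the two frames gives
  \<open>\<phi>\<^sub>p\<^sup>\<alpha> - \<phi>\<^sub>p\<^sup>\<beta> = ln |g\<^sub>p|\<close> (lemma \<open>weight_difference\<close>), which is pluriharmonic.  So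
  \<open>\<psi> = \<phi>\<^sup>\<alpha> - \<phi>\<^sup>\<beta>\<close> is the locally uniform limit of the pluriharmonic functions
  \<open>u\<^sub>p = (1 / a\<^sub>p) ln |g\<^sub>p|\<close>, and everything rests on the fact that pluriharmonicity is preserved
  by such limits.

  For this the complex gradients \<open>D\<^sub>p(z)v = g\<^sub>p'(z)v / (a\<^sub>p g\<^sub>p(z))\<close>, whose real parts are the
  differentials of \<open>u\<^sub>p\<close>, are shown to converge.  On a disc in a complex line, \<open>u\<^sub>p - u\<^sub>q\<close> is the
  real part of a holomorphic function \<open>H\<close>, and the derivative of \<open>H\<close> is controlled by the supremum of
  \<open>|Re H|\<close> (\<open>real_part_Cauchy_estimate\<close>).  As the bound does not depend on the direction
  of the line, the \<open>D\<^sub>p\<close> form a locally uniform Cauchy sequence (\<open>log_derivative_estimate\<close>).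
  Hence \<open>\<psi>\<close> is differentiable with differential \<open>Re D\<close> for \<open>D = lim D\<^sub>p\<close>
  (\<open>limit_has_limit_derivative\<close>), and each \<open>z \<mapsto> D(z)v\<close> is holomorphic as a locally uniform
  limit of holomorphic functions (\<open>holo_on_limit\<close>).  A real function whose differential is the
  real part of such a \<open>D\<close> is of class \<open>C\<^sup>2\<close> and is annihilated by \<open>\<partial>\<^sup>2/\<partial>z\<^sub>j\<partial>zbar\<^sub>k\<close>, because
  its \<open>zbar\<^sub>k\<close>-derivative is half the conjugate of a holomorphic function
  (\<open>real_part_of_holo_gradient_pluriharmonic\<close>).

  The two facts about holomorphic functions of several variables used here, closure under locally
  uniform limits and under directional differentiation, are reduced in the same way to the
  one-variable Cauchy inequalities on complex lines: the second follows from the first because the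
  difference quotients converge locally uniformly.
\<close>

section \<open>Holomorphic functions of several variables on complex lines\<close>

lemma norm_vector_smult: "norm (c *s v) = norm c * norm v" for v :: "complex^'n"
  by (simp add: norm_vec_def L2_set_right_distrib norm_mult)

lemma holo_on_has_derivative:
  assumes "holo_on S f" "z \<in> S"
  shows "(f has_derivative frechet_derivative f (at z)) (at z)"
  using assms unfolding holo_on_def
  using frechet_derivative_works by (metis differentiableI)

lemma holo_on_derivative_scale:
  assumes "holo_on S f" "z \<in> S"
  shows "frechet_derivative f (at z) (c *s v) = c * frechet_derivative f (at z) v"
  using assms unfolding holo_on_def
  by (metis frechet_derivative_at)

lemma holo_on_subset: "holo_on S f \<Longrightarrow> T \<subseteq> S \<Longrightarrow> holo_on T f"
  by (auto simp: holo_on_def)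

lemma holo_on_locally:
  assumes "\<And>z. z \<in> S \<Longrightarrow> \<exists>N. z \<in> N \<and> holo_on N f"
  shows "holo_on S f"
  using assms unfolding holo_on_def by blast

lemma holo_on_cong:
  assumes "holo_on S f" "open S" "\<And>z. z \<in> S \<Longrightarrow> f z = g z"
  shows "holo_on S g"
  unfolding holo_on_def
proof (intro ballI exI conjI)
  fix z assume z: "z \<in> S"
  show "(g has_derivative frechet_derivative f (at z)) (at z)"
    using holo_on_has_derivative[OF assms(1) z] assms(2) z assms(3)
    by (rule has_derivative_transform_within_open)
  show "\<forall>c v. frechet_derivative f (at z) (c *s v) = c * frechet_derivative f (at z) v"
    by (simp add: holo_on_derivative_scale[OF assms(1) z])
qed

lemma holo_on_continuous: "holo_on S f \<Longrightarrow> continuous_on S f"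
  by (meson continuous_at_imp_continuous_on has_derivative_continuous holo_on_has_derivative)

lemma holo_on_const: "holo_on S (\<lambda>z. c)"
  unfolding holo_on_def by (intro ballI exI[of _ "\<lambda>_. 0"]) auto

lemma holo_on_diff:
  assumes "holo_on S f" "holo_on S g"
  shows "holo_on S (\<lambda>z. f z - g z)"
  unfolding holo_on_def
proof (intro ballI exI conjI)
  fix z assume "z \<in> S"
  note D = assms[THEN holo_on_has_derivative, OF \<open>z \<in> S\<close>]
  show "((\<lambda>z. f z - g z) has_derivative
      (\<lambda>h. frechet_derivative f (at z) h - frechet_derivative g (at z) h)) (at z)"
    by (intro has_derivative_diff D)
  show "\<forall>c v. frechet_derivative f (at z) (c *s v) - frechet_derivative g (at z) (c *s v) =
      c * (frechet_derivative f (at z) v - frechet_derivative g (at z) v)"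
    by (simp add: assms[THEN holo_on_derivative_scale, OF \<open>z \<in> S\<close>] right_diff_distrib)
qed

lemma holo_on_mult:
  assumes "holo_on S f" "holo_on S g"
  shows "holo_on S (\<lambda>z. f z * g z)"
  unfolding holo_on_def
proof (intro ballI exI conjI)
  fix z assume "z \<in> S"
  note D = assms[THEN holo_on_has_derivative, OF \<open>z \<in> S\<close>]
  show "((\<lambda>z. f z * g z) has_derivative
      (\<lambda>h. f z * frechet_derivative g (at z) h + frechet_derivative f (at z) h * g z)) (at z)"
    by (intro has_derivative_mult D)
  show "\<forall>c v. f z * frechet_derivative g (at z) (c *s v) + frechet_derivative f (at z) (c *s v) * g z
      = c * (f z * frechet_derivative g (at z) v + frechet_derivative f (at z) v * g z)"
    by (simp add: assms[THEN holo_on_derivative_scale, OF \<open>z \<in> S\<close>] algebra_simps)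
qed

lemma holo_on_divide:
  assumes "holo_on S f" "holo_on S g" "\<And>z. z \<in> S \<Longrightarrow> g z \<noteq> 0"
  shows "holo_on S (\<lambda>z. f z / g z)"
  unfolding holo_on_def
proof (intro ballI exI conjI)
  fix z assume "z \<in> S"
  note D = assms(1,2)[THEN holo_on_has_derivative, OF \<open>z \<in> S\<close>]
  show "((\<lambda>z. f z / g z) has_derivative
      (\<lambda>h. (frechet_derivative f (at z) h * g z - f z * frechet_derivative g (at z) h) / (g z * g z))) (at z)"
    by (rule has_derivative_divide'[OF D assms(3)[OF \<open>z \<in> S\<close>]])
  show "\<forall>c v. (frechet_derivative f (at z) (c *s v) * g z - f z * frechet_derivative g (at z) (c *s v)) / (g z * g z)
      = c * ((frechet_derivative f (at z) v * g z - f z * frechet_derivative g (at z) v) / (g z * g z))"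
    by (simp add: assms(1,2)[THEN holo_on_derivative_scale, OF \<open>z \<in> S\<close>] algebra_simps)
qed

lemma holo_on_along_line:
  assumes "holo_on S f" "z + t *s v \<in> S"
  shows "((\<lambda>t. f (z + t *s v)) has_field_derivative
           frechet_derivative f (at (z + t *s v)) v) (at t)"
proof -
  have "linear (\<lambda>s. s *s v)"
    by (rule linearI) (auto simp: vec_eq_iff algebra_simps)
  then have "((\<lambda>s. s *s v) has_derivative (\<lambda>s. s *s v)) (at t)"
    by (simp add: bounded_linear_imp_has_derivative linear_conv_bounded_linear)
  then have 1: "((\<lambda>s. z + s *s v) has_derivative (\<lambda>s. s *s v)) (at t)"
    by (auto intro!: derivative_eq_intros)
  have "((\<lambda>s. f (z + s *s v)) has_derivative
      (\<lambda>s. frechet_derivative f (at (z + t *s v)) (s *s v))) (at t)"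
    using has_derivative_compose[OF 1 holo_on_has_derivative[OF assms]] .
  moreover have "(\<lambda>s. frechet_derivative f (at (z + t *s v)) (s *s v))
      = (*) (frechet_derivative f (at (z + t *s v)) v)"
    by (simp add: holo_on_derivative_scale[OF assms] fun_eq_iff)
  ultimately show ?thesis
    by (simp add: has_field_derivative_def)
qed

lemma holomorphic_on_line:
  assumes "holo_on S f" "\<And>t. t \<in> T \<Longrightarrow> z + t *s v \<in> S" "open T"
  shows "(\<lambda>t. f (z + t *s v)) holomorphic_on T"
  using holo_on_along_line[OF assms(1,2)] assms(3)
  unfolding holomorphic_on_open[OF assms(3)] by blast

lemma line_in_ball:
  fixes v :: "complex^'n"
  assumes "norm t * norm v < r"
  shows "z + t *s v \<in> ball z r"
  using assms by (simp add: dist_norm norm_vector_smult)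

text \<open>
  On the complex line through \<open>z\<close> in the direction \<open>v\<close>, the ball of radius \<open>r\<close> cuts out a disc of
  radius \<open>r / norm v\<close>, to which the one-variable Cauchy inequality applies.
\<close>

lemma Cauchy_estimate:
  assumes f: "holo_on S f" and S: "cball z r \<subseteq> S" "0 < r"
    and M: "\<And>w. w \<in> cball z r \<Longrightarrow> norm (f w) \<le> M"
  shows "norm (frechet_derivative f (at z) v) \<le> M / r * norm v"
proof (cases "v = 0")
  case True
  have "z \<in> S" using S by auto
  from holo_on_derivative_scale[OF f this, of 0 0] show ?thesis
    using True by simp
next
  case False
  define \<rho> where "\<rho> = r / norm v"
  have \<rho>: "0 < \<rho>" using False S by (simp add: \<rho>_def)
  have mem: "z + t *s v \<in> cball z r" if "norm t \<le> \<rho>" for t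
    using that False by (simp add: \<rho>_def dist_norm norm_vector_smult field_simps)
  define g where "g = (\<lambda>t. f (z + t *s v))"
  have der: "(g has_field_derivative frechet_derivative f (at (z + t *s v)) v) (at t)"
    if "norm t \<le> \<rho>" for t
    unfolding g_def using mem[OF that] S by (intro holo_on_along_line[OF f]) auto
  have "norm ((deriv ^^ 1) g 0) \<le> fact 1 * M / \<rho> ^ 1"
  proof (rule Cauchy_inequality)
    show "g holomorphic_on ball 0 \<rho>"
      using der by (force simp: holomorphic_on_open)
    show "continuous_on (cball 0 \<rho>) g"
      by (intro continuous_at_imp_continuous_on ballI DERIV_isCont[OF der]) auto
    show "norm (g x) \<le> M" if "norm (0 - x) = \<rho>" for x
      unfolding g_def using that by (intro M mem) auto
  qed (use \<rho> in auto)
  moreover have "deriv g 0 = frechet_derivative f (at z) v"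
    using DERIV_imp_deriv[OF der[of 0]] \<rho> by simp
  ultimately show ?thesis
    using False by (simp add: \<rho>_def field_simps)
qed

text \<open>
  A Borel--Caratheodory type bound: the values of \<open>exp (H / \<epsilon>)\<close> have modulus between \<open>exp (-1)\<close> and
  \<open>exp 1\<close>, so the Cauchy inequality for this function bounds its logarithmic derivative
  \<open>H' / \<epsilon>\<close> at the centre.
\<close>

lemma real_part_Cauchy_estimate:
  assumes H: "H holomorphic_on ball 0 R" and r: "0 < r" "r < R"
    and bound: "\<And>t. t \<in> ball 0 R \<Longrightarrow> \<bar>Re (H t)\<bar> \<le> \<epsilon>" and \<epsilon>: "0 < \<epsilon>"
  shows "norm (deriv H 0) \<le> exp 2 * \<epsilon> / r"
proof -
  define K where "K = (\<lambda>t. exp (H t / of_real \<epsilon>))"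
  have normK: "norm (K t) = exp (Re (H t) / \<epsilon>)" for t
    by (simp add: K_def norm_exp_eq_Re)
  have holK: "K holomorphic_on ball 0 R"
    unfolding K_def using \<epsilon> by (intro holomorphic_intros H) auto
  have "norm ((deriv ^^ 1) K 0) \<le> fact 1 * exp 1 / r ^ 1"
  proof (rule Cauchy_inequality)
    show "K holomorphic_on ball 0 r"
      using holK r by (rule_tac holomorphic_on_subset) auto
    show "continuous_on (cball 0 r) K"
      using holK r by (intro holomorphic_on_imp_continuous_on holomorphic_on_subset[OF holK]) auto
    show "norm (K x) \<le> exp 1" if "norm (0 - x) = r" for x
      unfolding normK using that r bound[of x] \<epsilon> by (auto simp: field_simps abs_le_iff)
  qed (use r in auto)
  moreover have "deriv K 0 = K 0 * (deriv H 0 / \<epsilon>)"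
  proof -
    have "(H has_field_derivative deriv H 0) (at 0)"
      using r by (intro holomorphic_derivI[OF H]) auto
    then show ?thesis
      unfolding K_def using \<epsilon> by (intro DERIV_imp_deriv) (auto intro!: derivative_eq_intros)
  qed
  ultimately have 1: "norm (K 0) * (norm (deriv H 0) / \<epsilon>) \<le> exp 1 / r"
    using \<epsilon> by (simp add: norm_mult norm_divide)
  have "exp (-1) \<le> norm (K 0)"
    unfolding normK using bound[of 0] r \<epsilon> by (auto simp: field_simps abs_le_iff)
  then have "exp (-1) * (norm (deriv H 0) / \<epsilon>) \<le> norm (K 0) * (norm (deriv H 0) / \<epsilon>)"
    using \<epsilon> by (intro mult_right_mono) auto
  with 1 have "exp (-1) * (norm (deriv H 0) / \<epsilon>) \<le> exp 1 / r" by linarith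
  then have "exp 1 * (exp (-1) * (norm (deriv H 0) / \<epsilon>)) \<le> exp 1 * (exp 1 / r)"
    by (intro mult_left_mono) auto
  moreover have "exp 1 * (exp (-1) * y) = y" for y :: real
    by (simp flip: mult.assoc exp_add)
  moreover have "exp 1 * (exp 1 / r) = exp 2 / r"
    by (simp flip: exp_add)
  ultimately show ?thesis
    using \<epsilon> r by (simp add: field_simps)
qed

text \<open>
  Two functions \<open>c\<^sub>1 ln |f|\<close> and \<open>c\<^sub>2 ln |g|\<close> that are uniformly close have close complex gradients:
  on each disc centred at \<open>z\<close> in a complex line there are holomorphic logarithms of \<open>f\<close> and \<open>g\<close>,
  and the real part of the combination \<open>c\<^sub>1 log f - c\<^sub>2 log g\<close> is small.
\<close>

lemma log_derivative_estimate:
  fixes c\<^sub>1 c\<^sub>2 :: real and f g :: "complex^'n \<Rightarrow> complex"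
  assumes f: "holo_on S f" "\<And>w. w \<in> S \<Longrightarrow> f w \<noteq> 0"
    and g: "holo_on S g" "\<And>w. w \<in> S \<Longrightarrow> g w \<noteq> 0"
    and S: "ball z (2 * r) \<subseteq> S" "0 < r" and \<epsilon>: "0 < \<epsilon>"
    and bound: "\<And>w. w \<in> ball z (2 * r) \<Longrightarrow>
      \<bar>c\<^sub>1 * ln (norm (f w)) - c\<^sub>2 * ln (norm (g w))\<bar> \<le> \<epsilon>"
  shows "norm (c\<^sub>1 * frechet_derivative f (at z) v / f z - c\<^sub>2 * frechet_derivative g (at z) v / g z)
    \<le> exp 2 * \<epsilon> / r * norm v"
proof (cases "v = 0")
  case True
  have "z \<in> S" using S by auto
  from holo_on_derivative_scale[OF f(1) this, of 0 0] holo_on_derivative_scale[OF g(1) this, of 0 0]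
  show ?thesis using True by simp
next
  case False
  define R where "R = 2 * r / norm v"
  have mem: "z + t *s v \<in> ball z (2 * r)" if "t \<in> ball 0 R" for t
    using that False by (intro line_in_ball) (simp add: R_def field_simps)
  have R: "0 < R" using S False by (simp add: R_def)
  \<comment> \<open>A logarithm along the line suffices, so that none is needed on the whole ball.\<close>
  have log: "\<exists>h. h holomorphic_on ball 0 R \<and> (\<forall>t\<in>ball 0 R. k (z + t *s v) = exp (h t))
      \<and> deriv h 0 = frechet_derivative k (at z) v / k z"
    if k: "holo_on S k" "\<And>w. w \<in> S \<Longrightarrow> k w \<noteq> 0" for k
  proof -
    have hol: "(\<lambda>t. k (z + t *s v)) holomorphic_on ball 0 R"
      using mem S by (intro holomorphic_on_line[OF k(1)]) auto
    moreover have "k (z + t *s v) \<noteq> 0" if "t \<in> ball 0 R" for t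
      using mem[OF that] S k(2) by blast
    ultimately obtain h where h: "h holomorphic_on ball 0 R"
        "\<And>t. t \<in> ball 0 R \<Longrightarrow> exp (h t) = k (z + t *s v)"
      using holomorphic_logarithm_exists[OF convex_ball open_ball, of "\<lambda>t. k (z + t *s v)" 0 R 0] R
      by auto
    have "(h has_field_derivative deriv h 0) (at 0)"
      using R by (intro holomorphic_derivI[OF h(1)]) auto
    then have "((\<lambda>t. exp (h t)) has_field_derivative exp (h 0) * deriv h 0) (at 0)"
      by (auto intro!: derivative_eq_intros)
    then have "((\<lambda>t. k (z + t *s v)) has_field_derivative exp (h 0) * deriv h 0) (at 0)"
      by (rule has_field_derivative_transform_within_open[where S = "ball 0 R"]) (use R h in auto)
    moreover have "((\<lambda>t. k (z + t *s v)) has_field_derivative frechet_derivative k (at z) v) (at 0)"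
      using holo_on_along_line[OF k(1), of z 0 v] subsetD[OF S(1), of z] S(2) by simp
    ultimately have "exp (h 0) * deriv h 0 = frechet_derivative k (at z) v"
      using DERIV_unique by blast
    moreover have "exp (h 0) = k z" using h(2)[of 0] R by simp
    moreover have "k z \<noteq> 0" using k(2)[of z] subsetD[OF S(1), of z] S(2) by simp
    ultimately have "deriv h 0 = frechet_derivative k (at z) v / k z" by (simp add: field_simps)
    with h show ?thesis by metis
  qed
  obtain hf where hf: "hf holomorphic_on ball 0 R" "\<And>t. t \<in> ball 0 R \<Longrightarrow> f (z + t *s v) = exp (hf t)"
      "deriv hf 0 = frechet_derivative f (at z) v / f z"
    using log[OF f] by blast
  obtain hg where hg: "hg holomorphic_on ball 0 R" "\<And>t. t \<in> ball 0 R \<Longrightarrow> g (z + t *s v) = exp (hg t)"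
      "deriv hg 0 = frechet_derivative g (at z) v / g z"
    using log[OF g] by blast
  define H where "H = (\<lambda>t. c\<^sub>1 * hf t - c\<^sub>2 * hg t)"
  have "norm (deriv H 0) \<le> exp 2 * \<epsilon> / (R / 2)"
  proof (rule real_part_Cauchy_estimate)
    show "H holomorphic_on ball 0 R"
      unfolding H_def by (intro holomorphic_intros hf hg)
    show "\<bar>Re (H t)\<bar> \<le> \<epsilon>" if "t \<in> ball 0 R" for t
      using bound[OF mem[OF that]] hf(2)[OF that] hg(2)[OF that]
      by (simp add: H_def norm_exp_eq_Re)
  qed (use R \<epsilon> in auto)
  moreover have "deriv H 0 = c\<^sub>1 * deriv hf 0 - c\<^sub>2 * deriv hg 0"
  proof -
    have "(hf has_field_derivative deriv hf 0) (at 0)" "(hg has_field_derivative deriv hg 0) (at 0)"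
      using R by (auto intro!: holomorphic_derivI[OF hf(1)] holomorphic_derivI[OF hg(1)])
    then show ?thesis
      unfolding H_def by (intro DERIV_imp_deriv) (auto intro!: derivative_eq_intros)
  qed
  ultimately show ?thesis
    using False S by (simp add: hf hg R_def field_simps)
qed

section \<open>Limits of functions with uniformly converging derivatives\<close>

lemma uniform_limit_imp_uniformly_Cauchy:
  fixes f :: "nat \<Rightarrow> 'a \<Rightarrow> 'b::real_normed_vector"
  assumes "uniform_limit T f l sequentially" "0 < \<epsilon>"
  shows "\<exists>N. \<forall>m\<ge>N. \<forall>n\<ge>N. \<forall>x\<in>T. norm (f m x - f n x) \<le> \<epsilon>"
proof -
  obtain N where N: "\<And>n x. n \<ge> N \<Longrightarrow> x \<in> T \<Longrightarrow> dist (f n x) (l x) < \<epsilon> / 2"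
    using uniform_limitD[OF assms(1), of "\<epsilon> / 2"] assms(2)
    by (auto simp: eventually_sequentially)
  have "norm (f m x - f n x) \<le> \<epsilon>" if "m \<ge> N" "n \<ge> N" "x \<in> T" for m n x
    using N[OF that(1,3)] N[OF that(2,3)] dist_triangle2[of "f m x" "f n x" "l x"]
    by (simp add: dist_norm)
  then show ?thesis by blast
qed

text \<open>
  The differentials are compared as linear maps, that is, relative to \<open>norm h\<close>: this is the operator
  norm written out for families \<open>D\<close> that need not be packaged as bounded linear functions.
\<close>

definition derivatives_locally_uniformly_Cauchy ::
  "'a::real_normed_vector set \<Rightarrow> (nat \<Rightarrow> 'a \<Rightarrow> 'a \<Rightarrow> 'b::real_normed_vector) \<Rightarrow> bool" where
  "derivatives_locally_uniformly_Cauchy S D \<longleftrightarrow>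
     (\<forall>z\<in>S. \<exists>r>0. ball z r \<subseteq> S \<and>
        (\<forall>\<epsilon>>0. \<exists>N. \<forall>m\<ge>N. \<forall>n\<ge>N. \<forall>w\<in>ball z r. \<forall>h. norm (D m w h - D n w h) \<le> \<epsilon> * norm h))"

lemma uniform_limit_of_derivatives:
  fixes D :: "nat \<Rightarrow> 'a::real_normed_vector \<Rightarrow> 'a \<Rightarrow> 'b::banach"
  assumes D: "derivatives_locally_uniformly_Cauchy S D" and z: "z \<in> S"
  shows "\<exists>r>0. ball z r \<subseteq> S \<and>
    (\<forall>\<epsilon>>0. \<forall>\<^sub>F n in sequentially. \<forall>w\<in>ball z r. \<forall>h.
       norm (D n w h - lim (\<lambda>k. D k w h)) \<le> \<epsilon> * norm h)"
proof -
  obtain r where r: "r > 0" "ball z r \<subseteq> S"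
    and cau: "\<And>\<epsilon>. \<epsilon> > 0 \<Longrightarrow> \<exists>N. \<forall>m\<ge>N. \<forall>n\<ge>N. \<forall>w\<in>ball z r. \<forall>h.
      norm (D m w h - D n w h) \<le> \<epsilon> * norm h"
    using D z unfolding derivatives_locally_uniformly_Cauchy_def by metis
  have lim: "(\<lambda>k. D k w h) \<longlonglongrightarrow> lim (\<lambda>k. D k w h)" if w: "w \<in> ball z r" for w h
  proof -
    have "Cauchy (\<lambda>k. D k w h)"
    proof (rule CauchyI)
      fix e :: real assume "0 < e"
      then have "0 < e / (2 * (norm h + 1))"
        by (intro divide_pos_pos mult_pos_pos add_nonneg_pos) auto
      from cau[OF this] w obtain N where N: "\<And>m n. m \<ge> N \<Longrightarrow> n \<ge> N \<Longrightarrow>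
        norm (D m w h - D n w h) \<le> e / (2 * (norm h + 1)) * norm h" by blast
      have "e / (2 * (norm h + 1)) * norm h \<le> e / (2 * (norm h + 1)) * (norm h + 1)"
        using \<open>0 < e\<close> by (intro mult_left_mono) auto
      also have "\<dots> = e / 2"
        using norm_ge_zero[of h] by (simp add: field_simps add_nonneg_eq_0_iff)
      also have "\<dots> < e" using \<open>0 < e\<close> by simp
      finally show "\<exists>M. \<forall>m\<ge>M. \<forall>n\<ge>M. norm (D m w h - D n w h) < e"
        using N by (meson le_less_trans)
    qed
    then show ?thesis
      by (simp add: Cauchy_convergent_iff convergent_LIMSEQ_iff)
  qed
  have "\<forall>\<^sub>F n in sequentially. \<forall>w\<in>ball z r. \<forall>h. norm (D n w h - lim (\<lambda>k. D k w h)) \<le> \<epsilon> * norm h"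
    if \<epsilon>: "\<epsilon> > 0" for \<epsilon>
  proof -
    obtain N where N: "\<forall>m\<ge>N. \<forall>n\<ge>N. \<forall>w\<in>ball z r. \<forall>h. norm (D m w h - D n w h) \<le> \<epsilon> * norm h"
      using cau[OF \<epsilon>] by blast
    have "norm (D n w h - lim (\<lambda>k. D k w h)) \<le> \<epsilon> * norm h" if "n \<ge> N" "w \<in> ball z r" for n w h
    proof (rule Lim_bounded)
      show "(\<lambda>k. norm (D n w h - D k w h)) \<longlonglongrightarrow> norm (D n w h - lim (\<lambda>k. D k w h))"
        by (intro tendsto_intros lim that)
      show "\<forall>k\<ge>N. norm (D n w h - D k w h) \<le> \<epsilon> * norm h"
        using N that by blast
    qed
    then show ?thesis unfolding eventually_sequentially by blast
  qed
  with r show ?thesis by blast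
qed

lemma limit_has_limit_derivative:
  fixes u :: "nat \<Rightarrow> 'a::real_normed_vector \<Rightarrow> 'b::banach"
  assumes D: "derivatives_locally_uniformly_Cauchy S D"
    and u: "\<And>n z. z \<in> S \<Longrightarrow> (u n has_derivative D n z) (at z)"
    and lim: "\<And>z. z \<in> S \<Longrightarrow> (\<lambda>n. u n z) \<longlonglongrightarrow> \<psi> z"
    and z: "z \<in> S"
  shows "(\<psi> has_derivative (\<lambda>h. lim (\<lambda>n. D n z h))) (at z)"
proof -
  obtain r where r: "r > 0" "ball z r \<subseteq> S"
    and unif: "\<And>\<epsilon>. \<epsilon> > 0 \<Longrightarrow> \<forall>\<^sub>F n in sequentially. \<forall>w\<in>ball z r. \<forall>h.
       norm (D n w h - lim (\<lambda>k. D k w h)) \<le> \<epsilon> * norm h"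
    using uniform_limit_of_derivatives[OF D z] by blast
  have "\<exists>g. \<forall>x\<in>ball z r. (\<lambda>n. u n x) \<longlonglongrightarrow> g x \<and>
      (g has_derivative (\<lambda>h. lim (\<lambda>k. D k x h))) (at x within ball z r)"
  proof (rule has_derivative_sequence)
    show "(u n has_derivative D n x) (at x within ball z r)" if "x \<in> ball z r" for n x
      by (rule has_derivative_at_withinI[OF u[OF subsetD[OF r(2) that]]])
    show "z \<in> ball z r" using r by simp
    show "\<forall>\<^sub>F n in sequentially. \<forall>w\<in>ball z r. \<forall>h.
       norm (D n w h - lim (\<lambda>k. D k w h)) \<le> \<epsilon> * norm h" if "\<epsilon> > 0" for \<epsilon>
      by (rule unif[OF that])
    show "(\<lambda>n. u n z) \<longlonglongrightarrow> \<psi> z" by (rule lim[OF z])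
  qed (rule convex_ball)
  then obtain g where g: "\<And>x. x \<in> ball z r \<Longrightarrow> (\<lambda>n. u n x) \<longlonglongrightarrow> g x"
    "\<And>x. x \<in> ball z r \<Longrightarrow> (g has_derivative (\<lambda>h. lim (\<lambda>k. D k x h))) (at x within ball z r)"
    by metis
  have "(g has_derivative (\<lambda>h. lim (\<lambda>k. D k z h))) (at z)"
    using g(2)[of z] r at_within_open[of z "ball z r"] by simp
  then show ?thesis
  proof (rule has_derivative_transform_within_open)
    show "g x = \<psi> x" if "x \<in> ball z r" for x
      using LIMSEQ_unique[OF g(1)[OF that] lim[OF subsetD[OF r(2) that]]] .
  qed (use r in auto)
qed

text \<open>
  Here the direction \<open>h\<close> is fixed, so that locally uniform convergence of the functions
  \<open>z \<mapsto> D n z h\<close> results.  In this form the limit can be shown to inherit regularity in \<open>z\<close>.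
\<close>

lemma derivatives_locally_uniform_limit:
  fixes D :: "nat \<Rightarrow> 'a::real_normed_vector \<Rightarrow> 'a \<Rightarrow> 'b::banach"
  assumes "derivatives_locally_uniformly_Cauchy S D" "z \<in> S"
  shows "\<exists>N. open N \<and> z \<in> N \<and> N \<subseteq> S \<and>
    uniform_limit N (\<lambda>n w. D n w h) (\<lambda>w. lim (\<lambda>n. D n w h)) sequentially"
proof -
  obtain r where r: "r > 0" "ball z r \<subseteq> S"
    and unif: "\<And>\<epsilon>. \<epsilon> > 0 \<Longrightarrow> \<forall>\<^sub>F n in sequentially. \<forall>w\<in>ball z r. \<forall>h.
       norm (D n w h - lim (\<lambda>k. D k w h)) \<le> \<epsilon> * norm h"
    using uniform_limit_of_derivatives[OF assms] by blast
  have "uniform_limit (ball z r) (\<lambda>n w. D n w h) (\<lambda>w. lim (\<lambda>n. D n w h)) sequentially"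
  proof (rule uniform_limitI)
    fix e :: real assume "0 < e"
    then have pos: "0 < e / (norm h + 1)"
      by (intro divide_pos_pos add_nonneg_pos) auto
    have "e / (norm h + 1) * norm h < e / (norm h + 1) * (norm h + 1)"
      using pos by (intro mult_strict_left_mono) auto
    also have "\<dots> = e"
      using norm_ge_zero[of h] by (simp add: add_nonneg_eq_0_iff)
    finally have "e / (norm h + 1) * norm h < e" .
    show "\<forall>\<^sub>F n in sequentially. \<forall>w\<in>ball z r.
        dist (D n w h) (lim (\<lambda>n. D n w h)) < e"
      using unif[OF pos]
    proof eventually_elim
      case (elim n)
      then show ?case
        using \<open>e / (norm h + 1) * norm h < e\<close> by (auto simp: dist_norm intro: le_less_trans)
    qed
  qed
  with r show ?thesis by (intro exI[of _ "ball z r"]) auto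
qed

text \<open>
  The Cauchy estimate for \<open>f m - f n\<close> makes the differentials locally uniformly Cauchy; complex
  linearity of the differential passes to the pointwise limit.
\<close>

lemma holo_on_limit:
  assumes S: "open S" and f: "\<And>n. holo_on S (f n)"
    and unif: "\<And>z. z \<in> S \<Longrightarrow> \<exists>N. open N \<and> z \<in> N \<and> uniform_limit N f \<psi> sequentially"
  shows "holo_on S \<psi>"
proof -
  define D where "D = (\<lambda>n z. frechet_derivative (f n) (at z))"
  have D: "derivatives_locally_uniformly_Cauchy S D"
    unfolding derivatives_locally_uniformly_Cauchy_def
  proof
    fix z assume "z \<in> S"
    obtain N where N: "open N" "z \<in> N" "uniform_limit N f \<psi> sequentially"
      using unif[OF \<open>z \<in> S\<close>] by blast
    obtain R where R: "R > 0" "ball z R \<subseteq> S \<inter> N"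
      using N S \<open>z \<in> S\<close> by (meson IntI open_Int open_contains_ball)
    define r where "r = R / 3"
    have sub: "cball w r \<subseteq> S \<inter> N" if "w \<in> ball z r" for w
    proof (rule order_trans[OF _ R(2)], rule subsetI)
      fix x assume "x \<in> cball w r"
      with that R(1) dist_triangle[of z x w] show "x \<in> ball z R"
        by (simp add: r_def)
    qed
    show "\<exists>r>0. ball z r \<subseteq> S \<and>
       (\<forall>\<epsilon>>0. \<exists>N. \<forall>m\<ge>N. \<forall>n\<ge>N. \<forall>w\<in>ball z r. \<forall>h. norm (D m w h - D n w h) \<le> \<epsilon> * norm h)"
    proof (intro exI[of _ r] conjI allI impI)
      show "r > 0" using R by (simp add: r_def)
      show "ball z r \<subseteq> S" using R by (auto simp: r_def)
      fix \<epsilon> :: real assume "\<epsilon> > 0"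
      with \<open>r > 0\<close> have "\<epsilon> * r > 0" by simp
      from uniform_limit_imp_uniformly_Cauchy[OF N(3) this]
      obtain k where k: "\<And>m n x. m \<ge> k \<Longrightarrow> n \<ge> k \<Longrightarrow> x \<in> N \<Longrightarrow> norm (f m x - f n x) \<le> \<epsilon> * r"
        by blast
      have "norm (D m w h - D n w h) \<le> \<epsilon> * norm h"
        if mn: "m \<ge> k" "n \<ge> k" and w: "w \<in> ball z r" for m n w h
      proof -
        have "w \<in> S" using sub[OF w] \<open>r > 0\<close> by auto
        have "norm (frechet_derivative (\<lambda>x. f m x - f n x) (at w) h) \<le> (\<epsilon> * r) / r * norm h"
        proof (rule Cauchy_estimate)
          show "holo_on S (\<lambda>x. f m x - f n x)"
            by (rule holo_on_diff) (rule f)+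
          show "cball w r \<subseteq> S" using sub[OF w] by auto
          show "norm (f m x - f n x) \<le> \<epsilon> * r" if "x \<in> cball w r" for x
            using sub[OF w] that by (intro k mn) auto
        qed fact
        moreover have "frechet_derivative (\<lambda>x. f m x - f n x) (at w) = (\<lambda>h. D m w h - D n w h)"
          unfolding D_def
          by (rule frechet_derivative_at[symmetric])
            (intro has_derivative_diff holo_on_has_derivative[OF f] \<open>w \<in> S\<close>)
        ultimately show ?thesis using \<open>r > 0\<close> by simp
      qed
      then show "\<exists>N. \<forall>m\<ge>N. \<forall>n\<ge>N. \<forall>w\<in>ball z r. \<forall>h. norm (D m w h - D n w h) \<le> \<epsilon> * norm h"
        by blast
    qed
  qed
  show ?thesis
    unfolding holo_on_def
  proof
    fix z assume z: "z \<in> S"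
    have lim: "(\<lambda>n. D n z v) \<longlonglongrightarrow> lim (\<lambda>n. D n z v)" for v
      using derivatives_locally_uniform_limit[OF D z, of v] by (blast dest: tendsto_uniform_limitI)
    show "\<exists>D. (\<psi> has_derivative D) (at z) \<and> (\<forall>c v. D (c *s v) = c * D v)"
    proof (intro exI[of _ "\<lambda>h. lim (\<lambda>n. D n z h)"] conjI allI)
      show "(\<psi> has_derivative (\<lambda>h. lim (\<lambda>n. D n z h))) (at z)"
      proof (rule limit_has_limit_derivative[OF D _ _ z])
        show "(f n has_derivative D n w) (at w)" if "w \<in> S" for n w
          unfolding D_def by (rule holo_on_has_derivative[OF f that])
        show "(\<lambda>n. f n w) \<longlonglongrightarrow> \<psi> w" if "w \<in> S" for w
          using unif[OF that] by (blast dest: tendsto_uniform_limitI)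
      qed
      fix c v
      have "(\<lambda>n. D n z (c *s v)) = (\<lambda>n. c * D n z v)"
        unfolding D_def by (intro ext holo_on_derivative_scale[OF f z])
      then show "lim (\<lambda>n. D n z (c *s v)) = c * lim (\<lambda>n. D n z v)"
        using tendsto_mult_left[OF lim] by (simp add: limI)
    qed
  qed
qed

section \<open>Derivatives of holomorphic functions are holomorphic\<close>

text \<open>
  The Taylor remainder of order two along the line, with the second derivative bounded by the Cauchy
  inequality on discs of radius \<open>\<rho>\<close>.
\<close>

lemma difference_quotient_estimate:
  assumes f: "holo_on S f" and S: "cball z (2 * r) \<subseteq> S" "0 < r"
    and M: "\<And>w. w \<in> cball z (2 * r) \<Longrightarrow> norm (f w) \<le> M"
    and \<rho>: "0 < \<rho>" "\<rho> * norm v \<le> r" and s: "norm s \<le> \<rho>" "s \<noteq> 0"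
  shows "norm ((f (z + s *s v) - f z) / s - frechet_derivative f (at z) v) \<le> 2 * M / \<rho>\<^sup>2 * norm s"
proof -
  define g where "g = (\<lambda>t. f (z + t *s v))"
  have mem: "z + t *s v \<in> cball z (2 * r)" if "norm t \<le> 2 * \<rho>" for t
  proof -
    have "norm t * norm v \<le> 2 * \<rho> * norm v" using that by (intro mult_right_mono) auto
    then show ?thesis using \<rho> by (simp add: dist_norm norm_vector_smult)
  qed
  have memS: "z + t *s v \<in> S" if "norm t \<le> 2 * \<rho>" for t
    using mem[OF that] S by blast
  have holg: "g holomorphic_on ball 0 (2 * \<rho>)"
    unfolding g_def by (intro holomorphic_on_line[OF f] memS) auto
  have contg: "continuous_on (cball 0 (2 * \<rho>)) g"
    unfolding g_def
    by (intro continuous_at_imp_continuous_on ballI DERIV_isCont[OF holo_on_along_line[OF f memS]]) auto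
  have g'': "norm ((deriv ^^ 2) g t) \<le> 2 * M / \<rho>\<^sup>2" if "norm t \<le> \<rho>" for t
  proof -
    have sub: "cball t \<rho> \<subseteq> cball 0 (2 * \<rho>)"
    proof
      fix x assume "x \<in> cball t \<rho>"
      with that dist_triangle[of 0 x t] show "x \<in> cball 0 (2 * \<rho>)" by simp
    qed
    have "norm ((deriv ^^ 2) g t) \<le> fact 2 * M / \<rho> ^ 2"
    proof (rule Cauchy_inequality)
      show "g holomorphic_on ball t \<rho>"
        using interior_mono[OF sub] by (intro holomorphic_on_subset[OF holg]) simp
      show "continuous_on (cball t \<rho>) g"
        by (rule continuous_on_subset[OF contg sub])
      show "norm (g x) \<le> M" if "norm (t - x) = \<rho>" for x
      proof -
        have "x \<in> cball t \<rho>" using that by (simp add: dist_norm)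
        then show ?thesis unfolding g_def using sub by (intro M mem) auto
      qed
    qed fact
    then show ?thesis by (simp add: fact_numeral)
  qed
  have "norm ((deriv ^^ 0) g s - (\<Sum>i\<le>1. (deriv ^^ i) g 0 * (s - 0) ^ i / fact i))
      \<le> 2 * M / \<rho>\<^sup>2 * norm (s - 0) ^ Suc 1 / fact 1"
  proof (rule complex_Taylor)
    show "convex (cball (0::complex) \<rho>)" by simp
    fix i x assume "x \<in> cball (0::complex) \<rho>"
    then have x: "x \<in> ball 0 (2 * \<rho>)" using \<rho> by auto
    show "((deriv ^^ i) g has_field_derivative (deriv ^^ Suc i) g x) (at x within cball 0 \<rho>)"
      using holomorphic_derivI[OF holomorphic_higher_deriv[OF holg open_ball] open_ball x]
      by (simp add: has_field_derivative_at_within)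
  next
    fix x assume "x \<in> cball (0::complex) \<rho>"
    then show "norm ((deriv ^^ Suc 1) g x) \<le> 2 * M / \<rho>\<^sup>2"
      using g''[of x] by (simp add: numeral_2_eq_2)
  qed (use s \<rho> in auto)
  moreover have "deriv g 0 = frechet_derivative f (at z) v"
    unfolding g_def using DERIV_imp_deriv[OF holo_on_along_line[OF f, of z 0 v]] memS[of 0] \<rho> by simp
  ultimately have "norm (f (z + s *s v) - f z - frechet_derivative f (at z) v * s) \<le> 2 * M / \<rho>\<^sup>2 * (norm s)\<^sup>2"
    by (simp add: g_def power2_eq_square diff_diff_eq)
  then have "norm (f (z + s *s v) - f z - frechet_derivative f (at z) v * s) / norm s
      \<le> 2 * M / \<rho>\<^sup>2 * (norm s)\<^sup>2 / norm s"
    by (rule divide_right_mono) simp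
  moreover have "(f (z + s *s v) - f z) / s - frechet_derivative f (at z) v
      = (f (z + s *s v) - f z - frechet_derivative f (at z) v * s) / s"
    using s by (simp add: field_simps)
  ultimately show ?thesis
    using s by (simp add: norm_divide power2_eq_square)
qed

lemma holo_on_shift:
  assumes "holo_on S f" "\<And>z. z \<in> T \<Longrightarrow> z + a \<in> S"
  shows "holo_on T (\<lambda>z. f (z + a))"
  unfolding holo_on_def
proof (intro ballI exI conjI)
  fix z assume "z \<in> T"
  note mem = assms(2)[OF this]
  have "((\<lambda>z. z + a) has_derivative (\<lambda>h. h)) (at z)"
    by (auto intro!: derivative_eq_intros)
  from has_derivative_compose[OF this holo_on_has_derivative[OF assms(1) mem]]
  show "((\<lambda>z. f (z + a)) has_derivative frechet_derivative f (at (z + a))) (at z)" .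
  show "\<forall>c v. frechet_derivative f (at (z + a)) (c *s v) = c * frechet_derivative f (at (z + a)) v"
    using holo_on_derivative_scale[OF assms(1) mem] by blast
qed

text \<open>
  The difference quotients in the direction \<open>v\<close> are holomorphic and converge locally uniformly, so
  \<open>holo_on_limit\<close> applies.
\<close>

lemma holo_on_derivative:
  assumes S: "open S" and f: "holo_on S f"
  shows "holo_on S (\<lambda>z. frechet_derivative f (at z) v)"
proof (rule holo_on_locally)
  fix z\<^sub>0 assume "z\<^sub>0 \<in> S"
  then obtain R where R: "R > 0" "cball z\<^sub>0 R \<subseteq> S"
    using S open_contains_cball by blast
  define r where "r = R / 3"
  have r: "r > 0" using R by (simp add: r_def)
  obtain M where M: "\<And>w. w \<in> cball z\<^sub>0 R \<Longrightarrow> norm (f w) \<le> M"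
  proof -
    have "compact (f ` cball z\<^sub>0 R)"
      by (intro compact_continuous_image continuous_on_subset[OF holo_on_continuous[OF f]] R) auto
    then have "bounded (f ` cball z\<^sub>0 R)" by (rule compact_imp_bounded)
    then obtain M where "\<forall>x\<in>f ` cball z\<^sub>0 R. norm x \<le> M"
      unfolding bounded_iff by (rule exE)
    then show ?thesis by (intro that[of M]) (rule bspec, assumption, rule imageI)
  qed
  have sub: "cball z (2 * r) \<subseteq> cball z\<^sub>0 R" if "z \<in> ball z\<^sub>0 r" for z
  proof
    fix x assume "x \<in> cball z (2 * r)"
    with that dist_triangle[of z\<^sub>0 x z] show "x \<in> cball z\<^sub>0 R" by (simp add: r_def)
  qed
  \<comment> \<open>Adding 1 to the denominator covers the direction \<open>v = 0\<close> as well.\<close>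
  define \<rho> where "\<rho> = r / (norm v + 1)"
  have pos: "norm v + 1 > 0" by (simp add: add_nonneg_pos)
  have \<rho>: "0 < \<rho>" "\<rho> * norm v \<le> r"
    using r pos by (auto simp: \<rho>_def field_simps)
  define s :: "nat \<Rightarrow> complex" where "s n = of_real (\<rho> / Suc n)" for n
  have norm_s: "norm (s n) = \<rho> / Suc n" for n
    using \<rho> unfolding s_def norm_of_real by simp
  have s: "norm (s n) \<le> \<rho>" "s n \<noteq> 0" for n
  proof -
    have "\<rho> / Suc n \<le> \<rho> / 1" using \<rho> by (intro divide_left_mono) auto
    then show "norm (s n) \<le> \<rho>" by (simp only: norm_s div_by_1)
    show "s n \<noteq> 0" using norm_s[of n] \<rho> by auto
  qed
  define q where "q = (\<lambda>n z. (f (z + s n *s v) - f z) / s n)"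
  have "holo_on (ball z\<^sub>0 r) (\<lambda>z. frechet_derivative f (at z) v)"
  proof (rule holo_on_limit)
    show "holo_on (ball z\<^sub>0 r) (q n)" for n
      unfolding q_def
    proof (intro holo_on_divide holo_on_diff holo_on_const holo_on_shift[OF f] holo_on_subset[OF f])
      fix z assume z: "z \<in> ball z\<^sub>0 r"
      have "norm (s n) * norm v \<le> r"
        using mult_right_mono[OF s(1)[of n], of "norm v"] \<rho> by simp
      then have "z + s n *s v \<in> cball z (2 * r)"
        using r by (simp add: dist_norm norm_vector_smult)
      then show "z + s n *s v \<in> S" using sub[OF z] R by blast
    next
      show "ball z\<^sub>0 r \<subseteq> S" using R by (auto simp: r_def)
    qed (use s in auto)
    fix z assume z: "z \<in> ball z\<^sub>0 r"
    have "uniform_limit (ball z\<^sub>0 r) q (\<lambda>z. frechet_derivative f (at z) v) sequentially"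
    proof (rule uniform_limitI)
      fix e :: real assume "0 < e"
      have "(\<lambda>n. 2 * M / \<rho>\<^sup>2 * (\<rho> / Suc n)) \<longlonglongrightarrow> 2 * M / \<rho>\<^sup>2 * 0"
        by (intro tendsto_mult_left LIMSEQ_Suc[OF lim_const_over_n])
      then have "\<forall>\<^sub>F n in sequentially. 2 * M / \<rho>\<^sup>2 * (\<rho> / Suc n) < e"
        using \<open>0 < e\<close> by (intro order_tendstoD) auto
      then show "\<forall>\<^sub>F n in sequentially. \<forall>z\<in>ball z\<^sub>0 r. dist (q n z) (frechet_derivative f (at z) v) < e"
      proof eventually_elim
        case (elim n)
        have "norm (q n z - frechet_derivative f (at z) v) \<le> 2 * M / \<rho>\<^sup>2 * norm (s n)"
          if "z \<in> ball z\<^sub>0 r" for z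
          unfolding q_def using sub[OF that] R M
          by (intro difference_quotient_estimate[OF f _ r _ \<rho> s]) auto
        with elim show ?case
          unfolding norm_s dist_norm by (meson le_less_trans)
      qed
    qed
    then show "\<exists>N. open N \<and> z \<in> N \<and> uniform_limit N q (\<lambda>z. frechet_derivative f (at z) v) sequentially"
      using z by (intro exI[of _ "ball z\<^sub>0 r"]) auto
  qed auto
  then show "\<exists>N. z\<^sub>0 \<in> N \<and> holo_on N (\<lambda>z. frechet_derivative f (at z) v)"
    using r by (intro exI[of _ "ball z\<^sub>0 r"]) auto
qed

section \<open>Locally uniform limits of logarithms of moduli are pluriharmonic\<close>

lemma ln_norm_has_derivative:
  fixes g :: "complex^'n \<Rightarrow> complex"
  assumes "holo_on S g" "z \<in> S" "g z \<noteq> 0"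
  shows "((\<lambda>w. c * ln (norm (g w))) has_derivative
    (\<lambda>h. Re (c * frechet_derivative g (at z) h / g z))) (at z)"
proof -
  have norm': "((\<lambda>w. norm (g w)) has_derivative (\<lambda>h. frechet_derivative g (at z) h \<bullet> sgn (g z))) (at z)"
    using has_derivative_compose[OF holo_on_has_derivative[OF assms(1,2)] has_derivative_norm[OF assms(3)]] .
  have "((\<lambda>w. ln (norm (g w))) has_derivative
     (\<lambda>h. (frechet_derivative g (at z) h \<bullet> sgn (g z)) * inverse (norm (g z)))) (at z)"
    using has_derivative_ln[OF _ norm'] assms(3) by simp
  then have 1: "((\<lambda>w. c * ln (norm (g w))) has_derivative
     (\<lambda>h. c * ((frechet_derivative g (at z) h \<bullet> sgn (g z)) * inverse (norm (g z))))) (at z)"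
    by (rule has_derivative_mult_right)
  have "(a \<bullet> sgn b) * inverse (norm b) = Re (a / b)" for a b :: complex
  proof -
    have "(a \<bullet> sgn b) * inverse (norm b) = (a \<bullet> b) / (norm b)\<^sup>2"
      by (simp add: sgn_div_norm power2_eq_square divide_inverse)
    also have "\<dots> = Re (a / b)"
      unfolding Re_divide cmod_power2 by (simp add: inner_complex_def)
    finally show ?thesis .
  qed
  with 1 assms(3) show ?thesis
    by (simp add: mult.assoc flip: times_divide_eq_right)
qed

text \<open>
  The limit has a complex gradient \<open>D\<close> which depends holomorphically on the point; locally, \<open>\<psi>\<close> is
  therefore the real part of a primitive of \<open>D\<close>.  For non-integral \<open>c n\<close> the power
  \<open>g n ^ c n\<close> is in general multivalued, which is why the argument works with the single-valued
  gradients \<open>c n * g n' / g n\<close>.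
\<close>

lemma limit_of_log_moduli:
  fixes g :: "nat \<Rightarrow> complex^'n \<Rightarrow> complex" and c :: "nat \<Rightarrow> real"
  assumes S: "open S" and g: "\<And>n. holo_on S (g n)" "\<And>n z. z \<in> S \<Longrightarrow> g n z \<noteq> 0"
    and unif: "\<And>z. z \<in> S \<Longrightarrow> \<exists>N. open N \<and> z \<in> N \<and>
      uniform_limit N (\<lambda>n w. c n * ln (norm (g n w))) \<psi> sequentially"
  shows "\<exists>D. (\<forall>v. holo_on S (\<lambda>z. D z v)) \<and>
    (\<forall>z\<in>S. (\<psi> has_derivative (\<lambda>v. Re (D z v))) (at z) \<and> (\<forall>a v. D z (a *s v) = a * D z v))"
proof -
  define u where "u = (\<lambda>n w. c n * ln (norm (g n w)))"
  define D where "D = (\<lambda>n z v. c n * frechet_derivative (g n) (at z) v / g n z)"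
  define D\<^sub>0 where "D\<^sub>0 = (\<lambda>z v. lim (\<lambda>n. D n z v))"
  have holo: "holo_on S (\<lambda>z. D n z v)" for n v
    unfolding D_def
    by (intro holo_on_divide holo_on_mult holo_on_const holo_on_derivative S g)
  have cau: "derivatives_locally_uniformly_Cauchy S D"
    unfolding derivatives_locally_uniformly_Cauchy_def
  proof
    fix z assume "z \<in> S"
    obtain N where N: "open N" "z \<in> N" "uniform_limit N u \<psi> sequentially"
      using unif[OF \<open>z \<in> S\<close>] unfolding u_def by blast
    obtain R where R: "R > 0" "ball z R \<subseteq> S \<inter> N"
      using N S \<open>z \<in> S\<close> by (meson IntI open_Int open_contains_ball)
    define r where "r = R / 3"
    have sub: "ball w (2 * r) \<subseteq> S \<inter> N" if "w \<in> ball z r" for w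
    proof (rule order_trans[OF _ R(2)], rule subsetI)
      fix x assume "x \<in> ball w (2 * r)"
      with that dist_triangle[of z x w] show "x \<in> ball z R"
        by (simp add: r_def)
    qed
    show "\<exists>r>0. ball z r \<subseteq> S \<and>
       (\<forall>\<epsilon>>0. \<exists>N. \<forall>m\<ge>N. \<forall>n\<ge>N. \<forall>w\<in>ball z r. \<forall>h. norm (D m w h - D n w h) \<le> \<epsilon> * norm h)"
    proof (intro exI[of _ r] conjI allI impI)
      show "r > 0" using R by (simp add: r_def)
      show "ball z r \<subseteq> S" using R by (auto simp: r_def)
      fix \<epsilon> :: real assume "\<epsilon> > 0"
      \<comment> \<open>Chosen so that the factor \<open>exp 2 / r\<close> of the gradient estimate turns \<open>\<delta>\<close> into \<open>\<epsilon>\<close>.\<close>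
      define \<delta> where "\<delta> = \<epsilon> * r / exp 2"
      have "\<delta> > 0" using \<open>\<epsilon> > 0\<close> \<open>r > 0\<close> by (simp add: \<delta>_def)
      from uniform_limit_imp_uniformly_Cauchy[OF N(3) this]
      obtain k where k: "\<And>m n x. m \<ge> k \<Longrightarrow> n \<ge> k \<Longrightarrow> x \<in> N \<Longrightarrow> \<bar>u m x - u n x\<bar> \<le> \<delta>"
        unfolding real_norm_def by blast
      have "norm (D m w h - D n w h) \<le> \<epsilon> * norm h"
        if mn: "m \<ge> k" "n \<ge> k" and w: "w \<in> ball z r" for m n w h
      proof -
        have "norm (D m w h - D n w h) \<le> exp 2 * \<delta> / r * norm h"
          unfolding D_def
        proof (rule log_derivative_estimate[OF g(1,2) g(1,2)])
          show "ball w (2 * r) \<subseteq> S" using sub[OF w] by blast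
          show "\<bar>c m * ln (norm (g m x)) - c n * ln (norm (g n x))\<bar> \<le> \<delta>" if "x \<in> ball w (2 * r)" for x
            using k[OF mn, of x] subsetD[OF sub[OF w] that] by (simp add: u_def)
        qed (use \<open>r > 0\<close> \<open>\<delta> > 0\<close> in simp_all)
        also have "exp 2 * \<delta> / r = \<epsilon>" using \<open>r > 0\<close> by (simp add: \<delta>_def)
        finally show ?thesis .
      qed
      then show "\<exists>N. \<forall>m\<ge>N. \<forall>n\<ge>N. \<forall>w\<in>ball z r. \<forall>h. norm (D m w h - D n w h) \<le> \<epsilon> * norm h"
        by blast
    qed
  qed
  then have cau_Re: "derivatives_locally_uniformly_Cauchy S (\<lambda>n z v. Re (D n z v))"
    unfolding derivatives_locally_uniformly_Cauchy_def real_norm_def minus_complex.simps(1)[symmetric]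
    using abs_Re_le_cmod order_trans by (smt (verit, ccfv_threshold))
  have tendsto: "(\<lambda>n. D n z v) \<longlonglongrightarrow> D\<^sub>0 z v" if "z \<in> S" for z v
    using derivatives_locally_uniform_limit[OF cau that, of v] unfolding D\<^sub>0_def by (blast dest: tendsto_uniform_limitI)
  have "holo_on S (\<lambda>z. D\<^sub>0 z v)" for v
  proof (rule holo_on_limit[OF S holo])
    fix z assume "z \<in> S"
    then show "\<exists>N. open N \<and> z \<in> N \<and> uniform_limit N (\<lambda>n z. D n z v) (\<lambda>z. D\<^sub>0 z v) sequentially"
      using derivatives_locally_uniform_limit[OF cau, of z v] unfolding D\<^sub>0_def by blast
  qed
  moreover have "(\<psi> has_derivative (\<lambda>v. Re (D\<^sub>0 z v))) (at z)" if z: "z \<in> S" for z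
  proof -
    have "(\<psi> has_derivative (\<lambda>v. lim (\<lambda>n. Re (D n z v)))) (at z)"
    proof (rule limit_has_limit_derivative[OF cau_Re _ _ z])
      show "(u n has_derivative (\<lambda>v. Re (D n w v))) (at w)" if "w \<in> S" for n w
        unfolding u_def D_def by (rule ln_norm_has_derivative[OF g(1) that g(2)[OF that]])
      show "(\<lambda>n. u n w) \<longlonglongrightarrow> \<psi> w" if "w \<in> S" for w
        using unif[OF that] unfolding u_def by (blast dest: tendsto_uniform_limitI)
    qed
    moreover have "lim (\<lambda>n. Re (D n z v)) = Re (D\<^sub>0 z v)" for v
      by (intro limI tendsto_Re tendsto z)
    ultimately show ?thesis by simp
  qed
  moreover have "D\<^sub>0 z (a *s v) = a * D\<^sub>0 z v" if z: "z \<in> S" for z a v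
  proof -
    have "(\<lambda>n. D n z (a *s v)) = (\<lambda>n. a * D n z v)"
      unfolding D_def by (simp add: holo_on_derivative_scale[OF g(1) z] mult_ac)
    then show ?thesis
      using tendsto_mult_left[OF tendsto[OF z]] tendsto[OF z, of "a *s v"] LIMSEQ_unique by metis
  qed
  ultimately show ?thesis by blast
qed

text \<open>
  Complex linearity gives \<open>D z (\<i> v) = \<i> D z v\<close>, so \<open>\<partial>u/\<partial>zbar\<^sub>k\<close> is half the conjugate of the
  holomorphic function \<open>z \<mapsto> D z (axis k 1)\<close>, and \<open>\<partial>/\<partial>z\<^sub>j\<close> kills conjugates of holomorphic
  functions.
\<close>

lemma real_part_of_holo_gradient_pluriharmonic:
  fixes D :: "complex^'n \<Rightarrow> complex^'n \<Rightarrow> complex"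
  assumes S: "open S" and D: "\<And>v. holo_on S (\<lambda>z. D z v)"
    and u: "\<And>z. z \<in> S \<Longrightarrow> (u has_derivative (\<lambda>v. Re (D z v))) (at z)"
    and scale: "\<And>z a v. z \<in> S \<Longrightarrow> D z (a *s v) = a * D z v"
  shows "Ck_on 2 S u"
    and "z \<in> S \<Longrightarrow> d_z j (d_zbar k (\<lambda>w. of_real (u w))) z = 0"
proof -
  have fr: "frechet_derivative u (at z) = (\<lambda>v. Re (D z v))" if "z \<in> S" for z
    using frechet_derivative_at[OF u[OF that]] by simp
  have second: "((\<lambda>w. frechet_derivative u (at w) v) has_derivative
      (\<lambda>h. Re (frechet_derivative (\<lambda>z. D z v) (at z) h))) (at z)" if "z \<in> S" for z v
    by (rule has_derivative_transform_within_open[OF has_derivative_Re[OF holo_on_has_derivative[OF D that]] S that])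
      (simp add: fr)
  have fr2: "frechet_derivative (\<lambda>w. frechet_derivative u (at w) v) (at z) =
      (\<lambda>h. Re (frechet_derivative (\<lambda>z. D z v) (at z) h))" if "z \<in> S" for z v
    using frechet_derivative_at[OF second[OF that]] by simp
  have "continuous_on S (\<lambda>z. frechet_derivative (\<lambda>w. frechet_derivative u (at w) v) (at z) h)" for v h
  proof -
    have "continuous_on S (\<lambda>z. Re (frechet_derivative (\<lambda>z. D z v) (at z) h))"
      by (intro continuous_on_Re holo_on_continuous holo_on_derivative S D)
    then show ?thesis by (rule continuous_on_eq) (simp add: fr2)
  qed
  moreover have "u differentiable (at z)"
    "(\<lambda>w. frechet_derivative u (at w) v) differentiable (at z)" if "z \<in> S" for z v
    using u[OF that] second[OF that] by (auto simp: differentiable_def)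
  ultimately show "Ck_on 2 S u"
    by (simp add: numeral_2_eq_2)

  assume z: "z \<in> S"
  have axis: "axis j \<i> = \<i> *s (axis j 1 :: complex^'n)" for j
    by (simp add: vec_eq_iff axis_def)
  have d_zbar: "d_zbar k (\<lambda>w. of_real (u w)) w = cnj (D w (axis k 1)) / 2" if "w \<in> S" for w
  proof -
    have "((\<lambda>w. complex_of_real (u w)) has_derivative (\<lambda>v. complex_of_real (Re (D w v)))) (at w)"
      by (rule has_derivative_of_real[OF u[OF that]])
    from frechet_derivative_at[OF this] have
      "frechet_derivative (\<lambda>w. complex_of_real (u w)) (at w) = (\<lambda>v. complex_of_real (Re (D w v)))" ..
    then show ?thesis
      by (simp add: d_zbar_def axis scale[OF that] complex_eq_iff)
  qed
  let ?D' = "frechet_derivative (\<lambda>w. D w (axis k 1)) (at z)"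
  have "((\<lambda>w. cnj (D w (axis k 1)) / 2) has_derivative (\<lambda>h. cnj (?D' h) / 2)) (at z)"
    by (intro bounded_linear.has_derivative[OF bounded_linear_divide] has_derivative_cnj holo_on_has_derivative[OF D z])
  then have "(d_zbar k (\<lambda>w. of_real (u w)) has_derivative (\<lambda>h. cnj (?D' h) / 2)) (at z)"
    by (rule has_derivative_transform_within_open[OF _ S z]) (simp add: d_zbar)
  from frechet_derivative_at[OF this] have
    "frechet_derivative (d_zbar k (\<lambda>w. of_real (u w))) (at z) = (\<lambda>h. cnj (?D' h) / 2)" ..
  then show "d_z j (d_zbar k (\<lambda>w. of_real (u w))) z = 0"
    unfolding d_z_def by (simp add: axis holo_on_derivative_scale[OF D z])
qed

section \<open>Charts and local trivialisations\<close>

lemma inv_into_chart: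
  assumes "is_chart X (U, \<kappa>)" "x \<in> U"
  shows "inv_into U \<kappa> (\<kappa> x) = x"
proof -
  have "inj_on \<kappa> (topspace (subtopology X U))"
    using assms by (auto simp: is_chart_def homeomorphic_eq_everything_map)
  moreover have "topspace (subtopology X U) = U"
    using assms openin_subset[of X U] by (auto simp: is_chart_def)
  ultimately show ?thesis using assms(2) by (simp add: inv_into_f_f)
qed

lemma chart_image_open:
  assumes c: "is_chart X (U, \<kappa>)" and W: "openin X W"
  shows "open (\<kappa> ` (U \<inter> W))"
proof -
  have "open_map (subtopology X U) (top_of_set (\<kappa> ` U)) \<kappa>"
    using c by (auto simp: is_chart_def homeomorphic_eq_everything_map)
  moreover have "openin (subtopology X U) (U \<inter> W)"
    using W by (auto simp: openin_subtopology)
  ultimately have "openin (top_of_set (\<kappa> ` U)) (\<kappa> ` (U \<inter> W))"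
    by (simp add: open_map_def)
  then show ?thesis
    using c openin_open_trans by (auto simp: is_chart_def)
qed

lemma coordinate_polydisc_openin: "coordinate_polydisc X A V \<Longrightarrow> openin X V"
  by (auto simp: coordinate_polydisc_def is_chart_def)

lemma local_trivialisationD:
  assumes "local_trivialisation X L (T, \<tau>)"
  shows "openin X T"
    and "homeomorphic_map (subtopology (lb_top L) (over L T))
       (prod_topology (subtopology X T) euclidean) (\<lambda>v. (lb_proj L v, \<tau> v))"
    and "x \<in> T \<Longrightarrow> \<tau> (lb_zero L x) = 0"
    and "x \<in> T \<Longrightarrow> v \<in> fibre L x \<Longrightarrow> \<tau> (lb_smul L c v) = c * \<tau> v"
  using assms unfolding local_trivialisation_def by simp_all

lemma holomorphic_line_bundleD:
  assumes "holomorphic_line_bundle X A L" "x \<in> topspace X"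
  shows "lb_zero L x \<in> fibre L x"
    and "v \<in> fibre L x \<Longrightarrow> lb_smul L c v \<in> fibre L x"
    and "\<exists>t\<in>lb_trivs L. local_trivialisation X L t \<and> x \<in> fst t"
proof -
  show "lb_zero L x \<in> fibre L x" "v \<in> fibre L x \<Longrightarrow> lb_smul L c v \<in> fibre L x"
    using assms unfolding holomorphic_line_bundle_def by simp_all
  have "(\<Union>t\<in>lb_trivs L. fst t) = topspace X" "\<forall>t\<in>lb_trivs L. local_trivialisation X L t"
    using assms(1) unfolding holomorphic_line_bundle_def by simp_all
  then show "\<exists>t\<in>lb_trivs L. local_trivialisation X L t \<and> x \<in> fst t"
    using assms(2) by blast
qed

lemma holomorphic_frameD:
  assumes "holomorphic_frame A L V e"
  shows "x \<in> V \<Longrightarrow> e x \<in> fibre L x"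
    and "x \<in> V \<Longrightarrow> e x \<noteq> lb_zero L x"
    and "(T, \<tau>) \<in> lb_trivs L \<Longrightarrow> (U, \<kappa>) \<in> A \<Longrightarrow>
      holo_on (\<kappa> ` (U \<inter> (T \<inter> V))) (\<tau> \<circ> e \<circ> inv_into U \<kappa>)"
  using assms unfolding holomorphic_frame_def holomorphic_fun_def by blast+

lemma trivialisation_inj:
  assumes T: "local_trivialisation X L (T, \<tau>)" "x \<in> T"
    and v: "v \<in> fibre L x" and w: "w \<in> fibre L x" and eq: "\<tau> v = \<tau> w"
  shows "v = w"
proof -
  have "inj_on (\<lambda>v. (lb_proj L v, \<tau> v)) (topspace (subtopology (lb_top L) (over L T)))"
    using local_trivialisationD(2)[OF T(1)] by (simp add: homeomorphic_eq_everything_map)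
  then show ?thesis
    by (rule inj_onD) (use T(2) v w eq in \<open>simp_all add: fibre_def over_def\<close>)
qed

lemma line_bundle_trivialisation:
  assumes "holomorphic_line_bundle X A L" "x \<in> topspace X"
  obtains T \<tau> where "(T, \<tau>) \<in> lb_trivs L" "local_trivialisation X L (T, \<tau>)" "x \<in> T"
proof -
  obtain t where "t \<in> lb_trivs L" "local_trivialisation X L t" "x \<in> fst t"
    using holomorphic_line_bundleD(3)[OF assms] by blast
  then show ?thesis using that[of "fst t" "snd t"] by simp
qed

text \<open>
  A trivialisation is injective on fibres and vanishes at the zero vector, which a frame avoids.
\<close>

lemma frame_trivialisation_nonzero:
  assumes L: "holomorphic_line_bundle X A L" and T: "local_trivialisation X L (T, \<tau>)" "x \<in> T"
    and x: "x \<in> topspace X" and e: "holomorphic_frame A L V e" "x \<in> V"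
  shows "\<tau> (e x) \<noteq> 0"
proof
  assume "\<tau> (e x) = 0"
  then have "e x = lb_zero L x"
    using local_trivialisationD(3)[OF T] holomorphic_frameD(1)[OF e] holomorphic_line_bundleD(1)[OF L x]
    by (intro trivialisation_inj[OF T]) simp_all
  then show False using holomorphic_frameD(2)[OF e] by contradiction
qed

section \<open>The transition function between two frames\<close>

text \<open>
  Choosing the factor pointwise in the fibre makes the function defined on the whole overlap and
  independent of local trivialisations, each of which computes it near a given point.
\<close>

definition frame_ratio :: "('a, 'b) line_bundle \<Rightarrow> ('a \<Rightarrow> 'b) \<Rightarrow> ('a \<Rightarrow> 'b) \<Rightarrow> 'a \<Rightarrow> complex" where
  "frame_ratio L e f x = (SOME c. f x = lb_smul L c (e x))"

lemma frame_ratio_eq: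
  assumes L: "holomorphic_line_bundle X A L" and x: "x \<in> topspace X"
    and e: "holomorphic_frame A L V e" "x \<in> V" and f: "holomorphic_frame A L W f" "x \<in> W"
  shows "f x = lb_smul L (frame_ratio L e f x) (e x)"
proof -
  obtain T \<tau> where T: "local_trivialisation X L (T, \<tau>)" "x \<in> T"
    using line_bundle_trivialisation[OF L x] by blast
  let ?c = "\<tau> (f x) / \<tau> (e x)"
  have fib: "e x \<in> fibre L x" "f x \<in> fibre L x"
    by (rule holomorphic_frameD(1)[OF e] holomorphic_frameD(1)[OF f])+
  have "f x = lb_smul L ?c (e x)"
  proof (rule trivialisation_inj[OF T fib(2)])
    show "lb_smul L ?c (e x) \<in> fibre L x"
      by (rule holomorphic_line_bundleD(2)[OF L x fib(1)])
    have "\<tau> (lb_smul L ?c (e x)) = ?c * \<tau> (e x)"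
      by (rule local_trivialisationD(4)[OF T fib(1)])
    then show "\<tau> (f x) = \<tau> (lb_smul L ?c (e x))"
      using frame_trivialisation_nonzero[OF L T x e] by simp
  qed
  then show ?thesis unfolding frame_ratio_def by (rule someI[of "\<lambda>c. f x = lb_smul L c (e x)"])
qed

lemma frame_ratio_trivialisation:
  assumes L: "holomorphic_line_bundle X A L" and x: "x \<in> topspace X"
    and e: "holomorphic_frame A L V e" "x \<in> V" and f: "holomorphic_frame A L W f" "x \<in> W"
    and T: "local_trivialisation X L (T, \<tau>)" "x \<in> T"
  shows "frame_ratio L e f x = \<tau> (f x) / \<tau> (e x)"
proof -
  have "\<tau> (f x) = frame_ratio L e f x * \<tau> (e x)"
    unfolding local_trivialisationD(4)[OF T holomorphic_frameD(1)[OF e], symmetric]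
      frame_ratio_eq[OF L x e f, symmetric] ..
  then show ?thesis using frame_trivialisation_nonzero[OF L T x e] by simp
qed

text \<open>
  Near each point the ratio is the quotient of the two frames read in one trivialisation.
\<close>

lemma frame_ratio_holo:
  fixes A :: "('a, 'n::finite) chart set"
  assumes M: "complex_manifold X A" and L: "holomorphic_line_bundle X A L"
    and V: "openin X V" and e: "holomorphic_frame A L V e"
    and W: "openin X W" and f: "holomorphic_frame A L W f"
    and c: "(U, \<kappa>) \<in> A"
  shows "holo_on (\<kappa> ` (U \<inter> (V \<inter> W))) (frame_ratio L e f \<circ> inv_into U \<kappa>)"
proof (rule holo_on_locally)
  fix z assume "z \<in> \<kappa> ` (U \<inter> (V \<inter> W))"
  then obtain x where x: "x \<in> U" "x \<in> V" "x \<in> W" "z = \<kappa> x" by auto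
  have chart: "is_chart X (U, \<kappa>)" using M c by (auto simp: complex_manifold_def)
  have "x \<in> topspace X" using x V openin_subset by blast
  then obtain T \<tau> where \<tau>: "(T, \<tau>) \<in> lb_trivs L" and T: "local_trivialisation X L (T, \<tau>)" "x \<in> T"
    by (rule line_bundle_trivialisation[OF L])
  define \<Omega> where "\<Omega> = \<kappa> ` (U \<inter> (T \<inter> V \<inter> W))"
  have "openin X T" by (rule local_trivialisationD(1)[OF T(1)])
  then have "open \<Omega>"
    unfolding \<Omega>_def using V W by (intro chart_image_open[OF chart] openin_Int)
  have holo_e: "holo_on \<Omega> ((\<tau> \<circ> e) \<circ> inv_into U \<kappa>)"
  proof (rule holo_on_subset)
    show "holo_on (\<kappa> ` (U \<inter> (T \<inter> V))) ((\<tau> \<circ> e) \<circ> inv_into U \<kappa>)"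
      by (rule holomorphic_frameD(3)[OF e \<tau> c])
  qed (auto simp: \<Omega>_def)
  have holo_f: "holo_on \<Omega> ((\<tau> \<circ> f) \<circ> inv_into U \<kappa>)"
  proof (rule holo_on_subset)
    show "holo_on (\<kappa> ` (U \<inter> (T \<inter> W))) ((\<tau> \<circ> f) \<circ> inv_into U \<kappa>)"
      by (rule holomorphic_frameD(3)[OF f \<tau> c])
  qed (auto simp: \<Omega>_def)
  have pt: "inv_into U \<kappa> w \<in> T \<inter> V \<inter> W" if "w \<in> \<Omega>" for w
    using that by (auto simp: \<Omega>_def inv_into_chart[OF chart])
  have top: "T \<inter> V \<inter> W \<subseteq> topspace X" using V openin_subset by blast
  have "holo_on \<Omega> (\<lambda>w. (\<tau> \<circ> f \<circ> inv_into U \<kappa>) w / (\<tau> \<circ> e \<circ> inv_into U \<kappa>) w)"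
  proof (rule holo_on_divide[OF holo_f holo_e])
    show "(\<tau> \<circ> e \<circ> inv_into U \<kappa>) w \<noteq> 0" if "w \<in> \<Omega>" for w
      using frame_trivialisation_nonzero[OF L T(1) _ _ e] pt[OF that] top by auto
  qed
  then have "holo_on \<Omega> (frame_ratio L e f \<circ> inv_into U \<kappa>)"
  proof (rule holo_on_cong[OF _ \<open>open \<Omega>\<close>])
    show "(\<tau> \<circ> f \<circ> inv_into U \<kappa>) w / (\<tau> \<circ> e \<circ> inv_into U \<kappa>) w = (frame_ratio L e f \<circ> inv_into U \<kappa>) w"
      if "w \<in> \<Omega>" for w
      using frame_ratio_trivialisation[OF L _ e _ f _ T(1), of "inv_into U \<kappa> w"] pt[OF that] top
      by auto
  qed
  moreover have "z \<in> \<Omega>" using x T by (auto simp: \<Omega>_def)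
  ultimately show "\<exists>N. z \<in> N \<and> holo_on N (frame_ratio L e f \<circ> inv_into U \<kappa>)" by blast
qed

lemma frame_ratio_nonzero:
  assumes L: "holomorphic_line_bundle X A L" and x: "x \<in> topspace X"
    and e: "holomorphic_frame A L V e" "x \<in> V" and f: "holomorphic_frame A L W f" "x \<in> W"
  shows "frame_ratio L e f x \<noteq> 0"
proof -
  obtain T \<tau> where T: "local_trivialisation X L (T, \<tau>)" "x \<in> T"
    using line_bundle_trivialisation[OF L x] by blast
  show ?thesis
    using frame_ratio_trivialisation[OF L x e f T] frame_trivialisation_nonzero[OF L T x e]
      frame_trivialisation_nonzero[OF L T x f] by simp
qed

text \<open>
  With \<open>f = c e\<close> at \<open>x\<close>, sesquilinearity gives \<open>h f f = |c|\<^sup>2 h e e\<close>, that is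
  \<open>exp (- 2 \<psi>) = |c|\<^sup>2 exp (- 2 \<phi>)\<close>.
\<close>

lemma weight_difference:
  assumes L: "holomorphic_line_bundle X A L" and h: "hermitian_metric X L h"
    and x: "x \<in> topspace X"
    and e: "holomorphic_frame A L V e" "x \<in> V" and f: "holomorphic_frame A L W f" "x \<in> W"
    and \<phi>: "local_weight h V e \<phi>" and \<psi>: "local_weight h W f \<psi>"
  shows "\<phi> x - \<psi> x = ln (norm (frame_ratio L e f x))"
proof -
  define c where "c = frame_ratio L e f x"
  have fib: "e x \<in> fibre L x" "f x \<in> fibre L x"
    by (rule holomorphic_frameD(1)[OF e] holomorphic_frameD(1)[OF f])+
  have fc: "f x = lb_smul L c (e x)" unfolding c_def by (rule frame_ratio_eq[OF L x e f])
  have smul: "h (lb_smul L c u) v = c * h u v" and sym: "h v u = cnj (h u v)"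
    if "u \<in> fibre L x" "v \<in> fibre L x" for u v c
    using h x that unfolding hermitian_metric_def by blast+
  have "h (f x) (f x) = c * h (e x) (f x)"
    using smul[OF fib(1,2), of c] fc by simp
  also have "h (e x) (f x) = cnj (h (f x) (e x))"
    by (rule sym) (rule fib)+
  also have "h (f x) (e x) = c * h (e x) (e x)"
    using smul[OF fib(1,1), of c] fc by simp
  also have "cnj (c * h (e x) (e x)) = cnj c * h (e x) (e x)"
    using \<phi> e by (simp add: local_weight_def)
  finally have "h (f x) (f x) = of_real ((norm c)\<^sup>2) * h (e x) (e x)"
    unfolding complex_norm_square by (simp only: mult.assoc)
  then have "complex_of_real (exp (- 2 * \<psi> x)) = of_real ((norm c)\<^sup>2 * exp (- 2 * \<phi> x))"
    using \<phi> \<psi> e f by (simp add: local_weight_def)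
  then have "exp (- 2 * \<psi> x) = (norm c)\<^sup>2 * exp (- 2 * \<phi> x)"
    by (rule of_real_eq_iff[THEN iffD1])
  then have "ln (exp (- 2 * \<psi> x)) = ln ((norm c)\<^sup>2 * exp (- 2 * \<phi> x))" by simp
  moreover have "c \<noteq> 0" unfolding c_def by (rule frame_ratio_nonzero[OF L x e f])
  ultimately show ?thesis
    unfolding c_def[symmetric] by (simp add: ln_mult ln_realpow)
qed

lemma uniform_limit_in_chart:
  assumes chart: "is_chart X (U, \<kappa>)" and W: "openin X W" "x \<in> W" "x \<in> U"
    and lim: "uniform_limit W f g sequentially"
    and F: "\<And>n y. y \<in> U \<inter> W \<Longrightarrow> F n (\<kappa> y) = f n y"
  shows "\<exists>N. open N \<and> \<kappa> x \<in> N \<and> uniform_limit N F (g \<circ> inv_into U \<kappa>) sequentially"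
proof (intro exI conjI)
  show "open (\<kappa> ` (U \<inter> W))" by (rule chart_image_open[OF chart W(1)])
  show "\<kappa> x \<in> \<kappa> ` (U \<inter> W)" using W by blast
  show "uniform_limit (\<kappa> ` (U \<inter> W)) F (g \<circ> inv_into U \<kappa>) sequentially"
  proof (rule uniform_limitI)
    fix e :: real assume "0 < e"
    from uniform_limitD[OF lim this]
    show "\<forall>\<^sub>F n in sequentially. \<forall>z\<in>\<kappa> ` (U \<inter> W). dist (F n z) ((g \<circ> inv_into U \<kappa>) z) < e"
      by eventually_elim (auto simp: F inv_into_chart[OF chart])
  qed
qed

section \<open>Pluriharmonicity of the differences of the limit weights\<close>

theorem proposition1p4:
  fixes X :: "'a topology"
    and A :: "('a, 'n::finite) chart set"
    and \<omega> :: "('a, 'n) form2"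
    and L :: "nat \<Rightarrow> ('a, 'b) line_bundle"
    and h :: "nat \<Rightarrow> 'b \<Rightarrow> 'b \<Rightarrow> complex"
    and I :: "'i set"
    and V :: "'i \<Rightarrow> 'a set"
    and e :: "nat \<Rightarrow> 'i \<Rightarrow> 'a \<Rightarrow> 'b"
    and \<phi>p :: "nat \<Rightarrow> 'i \<Rightarrow> 'a \<Rightarrow> real"
    and \<phi> :: "'i \<Rightarrow> 'a \<Rightarrow> real"
    and a :: "nat \<Rightarrow> real"
  assumes "kaehler_manifold X A \<omega>"
    and "compact_space X" and "connected_space X"
    and "\<And>p. 1 \<le> p \<Longrightarrow> holomorphic_line_bundle X A (L p)"
    and "\<And>p. 1 \<le> p \<Longrightarrow> pseudo_effective X A (L p)"
    and "\<And>p. 1 \<le> p \<Longrightarrow> continuous_hermitian_metric X A (L p) (h p)"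
    and "\<And>\<alpha>. \<alpha> \<in> I \<Longrightarrow> coordinate_polydisc X A (V \<alpha>)"
    and "(\<Union>\<alpha>\<in>I. V \<alpha>) = topspace X"
    and "\<And>p \<alpha>. 1 \<le> p \<Longrightarrow> \<alpha> \<in> I \<Longrightarrow> holomorphic_frame A (L p) (V \<alpha>) (e p \<alpha>)"
    and "\<And>p \<alpha>. 1 \<le> p \<Longrightarrow> \<alpha> \<in> I \<Longrightarrow> local_weight (h p) (V \<alpha>) (e p \<alpha>) (\<phi>p p \<alpha>)"
    and "\<And>\<alpha>. \<alpha> \<in> I \<Longrightarrow> continuous_map (subtopology X (V \<alpha>)) euclideanreal (\<phi> \<alpha>)"
    and "\<And>p. 1 \<le> p \<Longrightarrow> 0 < a p"
    and "filterlim a at_top sequentially"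
    and "\<And>\<alpha>. \<alpha> \<in> I \<Longrightarrow> locally_uniform_limit X (V \<alpha>) (\<lambda>p x. \<phi>p p \<alpha> x / a p) (\<phi> \<alpha>)"
  shows "\<forall>\<alpha>\<in>I. \<forall>\<beta>\<in>I. \<exists>\<psi>. pluriharmonic A (V \<alpha> \<inter> V \<beta>) \<psi> \<and>
           (\<forall>x\<in>V \<alpha> \<inter> V \<beta>. \<phi> \<alpha> x = \<phi> \<beta> x + \<psi> x)"
proof (intro ballI)
  fix \<alpha> \<beta> assume \<alpha>: "\<alpha> \<in> I" and \<beta>: "\<beta> \<in> I"
  note L = assms(4) and frame = assms(9) and weight = assms(10)
  define \<psi> where "\<psi> = (\<lambda>x. \<phi> \<alpha> x - \<phi> \<beta> x)"
  have M: "complex_manifold X A" using assms(1) by (simp add: kaehler_manifold_def)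
  have V: "openin X (V \<alpha>)" "openin X (V \<beta>)"
    using assms(7) \<alpha> \<beta> coordinate_polydisc_openin by blast+
  have "Ck_on 2 (\<kappa> ` (U \<inter> (V \<alpha> \<inter> V \<beta>))) (\<psi> \<circ> inv_into U \<kappa>) \<and>
        (\<forall>z\<in>\<kappa> ` (U \<inter> (V \<alpha> \<inter> V \<beta>)). \<forall>j k.
           d_z j (d_zbar k (\<lambda>w. of_real (\<psi> (inv_into U \<kappa> w)))) z = 0)"
    if c: "(U, \<kappa>) \<in> A" for U \<kappa>
  proof -
    have chart: "is_chart X (U, \<kappa>)" using M c by (auto simp: complex_manifold_def)
    define S where "S = \<kappa> ` (U \<inter> (V \<alpha> \<inter> V \<beta>))"
    have S: "open S" unfolding S_def by (intro chart_image_open[OF chart] openin_Int V)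
    \<comment> \<open>The bundles are indexed from 1, hence the shift by \<open>Suc\<close>.\<close>
    define r where "r = (\<lambda>n. frame_ratio (L (Suc n)) (e (Suc n) \<alpha>) (e (Suc n) \<beta>))"
    have "\<exists>D. (\<forall>v. holo_on S (\<lambda>z. D z v)) \<and>
      (\<forall>z\<in>S. ((\<psi> \<circ> inv_into U \<kappa>) has_derivative (\<lambda>v. Re (D z v))) (at z) \<and>
        (\<forall>a v. D z (a *s v) = a * D z v))"
    proof (rule limit_of_log_moduli[OF S, of "\<lambda>n. r n \<circ> inv_into U \<kappa>" "\<lambda>n. 1 / a (Suc n)"])
      show "holo_on S (r n \<circ> inv_into U \<kappa>)" for n
        unfolding S_def r_def
        by (rule frame_ratio_holo[OF M L V(1) frame V(2) frame c]) (use \<alpha> \<beta> in auto)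
      show "(r n \<circ> inv_into U \<kappa>) z \<noteq> 0" if z: "z \<in> S" for n z
      proof -
        obtain x where x: "x \<in> U" "x \<in> V \<alpha>" "x \<in> V \<beta>" "z = \<kappa> x" using z by (auto simp: S_def)
        have "x \<in> topspace X" using x V openin_subset by blast
        then show ?thesis
          using frame_ratio_nonzero[OF L _ frame[OF _ \<alpha>] x(2) frame[OF _ \<beta>] x(3), of "Suc n"]
          by (simp add: r_def x inv_into_chart[OF chart])
      qed
      fix z assume "z \<in> S"
      then obtain x where x: "x \<in> U" "x \<in> V \<alpha>" "x \<in> V \<beta>" "z = \<kappa> x" by (auto simp: S_def)
      obtain W\<^sub>1 where W\<^sub>1: "openin X W\<^sub>1" "x \<in> W\<^sub>1" "W\<^sub>1 \<subseteq> V \<alpha>"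
        "uniform_limit W\<^sub>1 (\<lambda>p x. \<phi>p p \<alpha> x / a p) (\<phi> \<alpha>) sequentially"
        using assms(14)[OF \<alpha>] x unfolding locally_uniform_limit_def by blast
      obtain W\<^sub>2 where W\<^sub>2: "openin X W\<^sub>2" "x \<in> W\<^sub>2" "W\<^sub>2 \<subseteq> V \<beta>"
        "uniform_limit W\<^sub>2 (\<lambda>p x. \<phi>p p \<beta> x / a p) (\<phi> \<beta>) sequentially"
        using assms(14)[OF \<beta>] x unfolding locally_uniform_limit_def by blast
      have "uniform_limit (W\<^sub>1 \<inter> W\<^sub>2) (\<lambda>p x. \<phi>p p \<alpha> x / a p - \<phi>p p \<beta> x / a p) \<psi> sequentially"
        unfolding \<psi>_def
        by (intro uniform_limit_minus uniform_limit_on_subset[OF W\<^sub>1(4)] uniform_limit_on_subset[OF W\<^sub>2(4)]) auto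
      then have lim: "uniform_limit (W\<^sub>1 \<inter> W\<^sub>2)
          (\<lambda>n x. \<phi>p (Suc n) \<alpha> x / a (Suc n) - \<phi>p (Suc n) \<beta> x / a (Suc n)) \<psi> sequentially"
        by (rule filterlim_compose[OF _ filterlim_Suc])
      show "\<exists>N. open N \<and> z \<in> N \<and> uniform_limit N
          (\<lambda>n w. 1 / a (Suc n) * ln (norm ((r n \<circ> inv_into U \<kappa>) w))) (\<psi> \<circ> inv_into U \<kappa>) sequentially"
        unfolding x(4)
      proof (rule uniform_limit_in_chart[OF chart _ _ x(1) lim])
        show "openin X (W\<^sub>1 \<inter> W\<^sub>2)" "x \<in> W\<^sub>1 \<inter> W\<^sub>2" using W\<^sub>1 W\<^sub>2 by auto
        fix n y assume y: "y \<in> U \<inter> (W\<^sub>1 \<inter> W\<^sub>2)"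
        then have yV: "y \<in> V \<alpha>" "y \<in> V \<beta>" using W\<^sub>1 W\<^sub>2 by auto
        then have "y \<in> topspace X" using V openin_subset by blast
        moreover have "hermitian_metric X (L (Suc n)) (h (Suc n))"
          using assms(6)[of "Suc n"] by (simp add: continuous_hermitian_metric_def)
        ultimately have "\<phi>p (Suc n) \<alpha> y - \<phi>p (Suc n) \<beta> y = ln (norm (r n y))"
          unfolding r_def
          by (intro weight_difference[OF L _ _ frame[OF _ \<alpha>] yV(1) frame[OF _ \<beta>] yV(2) weight weight])
            (use \<alpha> \<beta> in auto)
        then show "1 / a (Suc n) * ln (norm ((r n \<circ> inv_into U \<kappa>) (\<kappa> y))) =
            \<phi>p (Suc n) \<alpha> y / a (Suc n) - \<phi>p (Suc n) \<beta> y / a (Suc n)"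
          using y by (simp add: inv_into_chart[OF chart] flip: diff_divide_distrib)
      qed
    qed
    then obtain D where D: "\<And>v. holo_on S (\<lambda>z. D z v)"
        "\<And>z. z \<in> S \<Longrightarrow> ((\<psi> \<circ> inv_into U \<kappa>) has_derivative (\<lambda>v. Re (D z v))) (at z)"
        "\<And>z a v. z \<in> S \<Longrightarrow> D z (a *s v) = a * D z v"
      by blast
    show ?thesis
      using real_part_of_holo_gradient_pluriharmonic[OF S D] by (simp add: S_def)
  qed
  then have "pluriharmonic A (V \<alpha> \<inter> V \<beta>) \<psi>"
    unfolding pluriharmonic_def by blast
  then show "\<exists>\<psi>. pluriharmonic A (V \<alpha> \<inter> V \<beta>) \<psi> \<and> (\<forall>x\<in>V \<alpha> \<inter> V \<beta>. \<phi> \<alpha> x = \<phi> \<beta> x + \<psi> x)"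
    by (intro exI[of _ \<psi>]) (auto simp: \<psi>_def)
qed

end
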